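(* Let $\sigma\in\mathcal S_{0,\infty}$ be given and let the growth condition (defined in the context) hold for $\sigma$. The following statements are equivalent: (i) There exist $M\ge1$, $\alpha>0$ and $\rho\in(0,1)$ such that $\|U_\sigma(t,s)\|\le M\rho^{\kappa_\sigma(t,s)}e^{-\alpha(t-s)}$ for all $t\ge s\ge0$ (strong GES). (ii) There exist $p\ge1$ and $b>0$ such that $$\int_s^\infty\|U_\sigma(t,s)x\|^p\,dt+\sum_{k\ge1,\ t_k>s}\|U_\sigma(t_k^-,s)x\|^p\le b^p\|x\|^p$$ for all $s\ge0$ and all $x\in X$. (iii) There exist a functional $V:\mathbb R_{\ge0}\times X\to\mathbb R_{\ge0}$, Lipschitz on bounded subsets of $X$ uniformly in $t$ and piecewise right-continuous in $t$ (see context), and constants $p\ge1$, $c>0$ such that for all $x\in X$ $$V(t,x)\le c\|x\|^p\quad\forall t\ge0,\qquad \underline D^+V(t,x)\le-\|x\|^p\quad\forall t\ge0,\qquad V(t,Jx)-V(t^-,x)\le-\|x\|^p\quad\forall t\in\mathbb T_\sigma.$$ Moreover, when (i) holds, an explicit functional witnessing (iii) is $$V(t,x):=\int_t^\infty\|U_\sigma(s,t)x\|^p\,ds+\sum_{k\ge1:\ t_k>t}\|U_\sigma(t_k^-,t)x\|^p,\qquad t\ge0,\ x\in X.$$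
   Context: Setting. $X$ is a Banach space with norm $\|\cdot\|$; $A:D(A)\subset X\to X$ generates a strongly continuous ($C_0$) semigroup $(S(t))_{t\ge0}$ on $X$; $J\in L(X)$ is bounded, $J\neq0$, $JD(A)\subset D(A)$. $\mathcal S_{0,\infty}$ is the set of sequences $\sigma=\{t_k\}_{k\ge1}$ with, setting $t_0:=0$, $t_{k+1}>t_k$ for all $k\ge0$ and $t_k\to\infty$; $\mathbb T_\sigma:=\{t_k:k\ge1\}$. The impulsive system is $\dot x(t)=Ax(t)$ for $t\notin\mathbb T_\sigma$, $x(t)=Jx(t^-)$ for $t\in\mathbb T_\sigma$. Its propagator $U_\sigma(t,s)$, $t\ge s\ge0$, is: $U_\sigma(t,s)=S(t-s)$ if $(s,t]\cap\mathbb T_\sigma=\varnothing$; otherwise, if $t_l<\dots<t_m$ are the impulse times in $(s,t]$, $U_\sigma(t,s)=S(t-t_m)JS(t_m-t_{m-1})J\cdots JS(t_l-s)$. For $s<t_k$, $U_\sigma(t_k^-,s)x:=\lim_{t\uparrow t_k}U_\sigma(t,s)x$. $\kappa_\sigma(t,s):=\#(\mathbb T_\sigma\cap(s,t])$. Growth condition for $\sigma$: there exist a piecewise continuous $g:\mathbb R_{\ge0}\to\mathbb R_{>0}$ bounded below by some $c_0>0$, and $\mu>1$, such that $\|U_\sigma(t,s)x\|\le g(t-s)\mu^{\kappa_\sigma(t,s)}\|x\|$ for all $t\ge s\ge0$, $x\in X$, and $G:=\sup_{0\le\tau<\bar T}g(\tau)<\infty$, where $\bar T:=\sup_{k\ge0}(t_{k+1}-t_k)\in(0,\infty]$.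 Functionals. $V$ is Lipschitz on bounded subsets of $X$ uniformly in $t$ if for every $r>0$ there is $L_r>0$ with $|V(t,x)-V(t,y)|\le L_r\|x-y\|$ for all $\|x\|<r$, $\|y\|<r$, $t\ge0$. Piecewise right-continuous in $t$ means: for each $x$, $t\mapsto V(t,x)$ is continuous on each $[t_k,t_{k+1})$, $k\ge0$, and has left limits $V(t_k^-,x):=\lim_{t\uparrow t_k}V(t,x)$ at impulse times. The lower right-hand Dini derivative along the flow is $$\underline D^+V(t,x):=\liminf_{h\downarrow0}\frac{V(t+h,S(h)x)-V(t,x)}{h}.$$ *)

theory Defs
  imports "HOL-Analysis.Analysis"
begin

definition C0_semigroup :: "(real \<Rightarrow> 'a::banach \<Rightarrow>\<^sub>L 'a) \<Rightarrow> bool" where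
  "C0_semigroup S \<longleftrightarrow>
     S 0 = id_blinfun \<and>
     (\<forall>t\<ge>0. \<forall>s\<ge>0. S (t + s) = S t o\<^sub>L S s) \<and>
     (\<forall>x. ((\<lambda>t. S t x) \<longlongrightarrow> x) (at_right 0))"

text \<open>The partial operator \<open>A : D \<rightarrow> X\<close> is a total function together with its domain \<open>D\<close>;
  the values of \<open>A\<close> outside \<open>D\<close> are irrelevant.\<close>

definition generates :: "'a set \<Rightarrow> ('a \<Rightarrow> 'a) \<Rightarrow> (real \<Rightarrow> 'a::banach \<Rightarrow>\<^sub>L 'a) \<Rightarrow> bool" where
  "generates D A S \<longleftrightarrow>
     C0_semigroup S \<and>
     D = {x. \<exists>y. ((\<lambda>h. (S h x - x) /\<^sub>R h) \<longlongrightarrow> y) (at_right 0)} \<and>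
     (\<forall>x\<in>D. ((\<lambda>h. (S h x - x) /\<^sub>R h) \<longlongrightarrow> A x) (at_right 0))"

text \<open>An impulse sequence \<open>{t\<^sub>k}\<close>, \<open>k \<ge> 1\<close>, is stored together with the convention \<open>t\<^sub>0 = 0\<close>;
  the time \<open>\<sigma> 0\<close> is not an impulse time.\<close>

definition impulse_sequences :: "(nat \<Rightarrow> real) set" where
  "impulse_sequences = {\<sigma>. \<sigma> 0 = 0 \<and> strict_mono \<sigma> \<and> filterlim \<sigma> at_top sequentially}"

definition impulse_times :: "(nat \<Rightarrow> real) \<Rightarrow> real set" where
  "impulse_times \<sigma> = \<sigma> ` {1..}"

definition impulse_count :: "(nat \<Rightarrow> real) \<Rightarrow> real \<Rightarrow> real \<Rightarrow> nat" where
  "impulse_count \<sigma> t s = card (impulse_times \<sigma> \<inter> {s<..t})"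

definition sup_dwell :: "(nat \<Rightarrow> real) \<Rightarrow> ereal" where
  "sup_dwell \<sigma> = (SUP k. ereal (\<sigma> (Suc k) - \<sigma> k))"

text \<open>\<open>flow_along S J t s [t\<^sub>l, \<dots>, t\<^sub>m]\<close> is \<open>S(t - t\<^sub>m) J S(t\<^sub>m - t\<^sub>m\<^sub>-\<^sub>1) J \<dots> J S(t\<^sub>l - s)\<close>.\<close>

fun flow_along ::
  "(real \<Rightarrow> 'a::banach \<Rightarrow>\<^sub>L 'a) \<Rightarrow> ('a \<Rightarrow>\<^sub>L 'a) \<Rightarrow> real \<Rightarrow> real \<Rightarrow> real list \<Rightarrow> 'a \<Rightarrow>\<^sub>L 'a" where
  "flow_along S J t s [] = S (t - s)"
| "flow_along S J t s (r # rs) = flow_along S J t r rs o\<^sub>L J o\<^sub>L S (r - s)"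

text \<open>Meaningful for \<open>t \<ge> s \<ge> 0\<close> only.\<close>

definition propagator ::
  "(real \<Rightarrow> 'a::banach \<Rightarrow>\<^sub>L 'a) \<Rightarrow> ('a \<Rightarrow>\<^sub>L 'a) \<Rightarrow> (nat \<Rightarrow> real) \<Rightarrow> real \<Rightarrow> real \<Rightarrow> 'a \<Rightarrow>\<^sub>L 'a" where
  "propagator S J \<sigma> t s =
     flow_along S J t s (sorted_list_of_set (impulse_times \<sigma> \<inter> {s<..t}))"

definition propagator_left ::
  "(real \<Rightarrow> 'a::banach \<Rightarrow>\<^sub>L 'a) \<Rightarrow> ('a \<Rightarrow>\<^sub>L 'a) \<Rightarrow> (nat \<Rightarrow> real) \<Rightarrow> real \<Rightarrow> real \<Rightarrow> 'a \<Rightarrow> 'a" where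
  "propagator_left S J \<sigma> t s x = Lim (at_left t) (\<lambda>\<tau>. propagator S J \<sigma> \<tau> s x)"

text \<open>Piecewise continuity on \<open>[0, \<infinity>)\<close>: finitely many discontinuities in each bounded interval,
  all of them with finite one-sided limits.\<close>

definition piecewise_continuous :: "(real \<Rightarrow> real) \<Rightarrow> bool" where
  "piecewise_continuous g \<longleftrightarrow>
     (\<exists>D\<subseteq>{0..}.
        (\<forall>b. finite (D \<inter> {0..b})) \<and>
        (\<forall>t\<in>{0..} - D. continuous (at t within {0..}) g) \<and>
        (\<forall>t\<in>D. (\<exists>l. (g \<longlongrightarrow> l) (at_right t)) \<and>
                (t > 0 \<longrightarrow> (\<exists>l. (g \<longlongrightarrow> l) (at_left t)))))"

definition growth_condition ::
  "(real \<Rightarrow> 'a::banach \<Rightarrow>\<^sub>L 'a) \<Rightarrow> ('a \<Rightarrow>\<^sub>L 'a) \<Rightarrow> (nat \<Rightarrow> real) \<Rightarrow> bool" where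
  "growth_condition S J \<sigma> \<longleftrightarrow>
     (\<exists>g \<mu>. piecewise_continuous g \<and>
        (\<exists>c0>0. \<forall>\<tau>\<ge>0. c0 \<le> g \<tau>) \<and>
        \<mu> > 1 \<and>
        (\<forall>s\<ge>0. \<forall>t\<ge>s. \<forall>x.
           norm (propagator S J \<sigma> t s x) \<le> g (t - s) * \<mu> ^ impulse_count \<sigma> t s * norm x) \<and>
        bdd_above (g ` {\<tau>. 0 \<le> \<tau> \<and> ereal \<tau> < sup_dwell \<sigma>}))"

definition lipschitz_on_bounded :: "(real \<Rightarrow> 'a::banach \<Rightarrow> real) \<Rightarrow> bool" where
  "lipschitz_on_bounded V \<longleftrightarrow>
     (\<forall>r>0. \<exists>L>0. \<forall>t\<ge>0. L-lipschitz_on (ball 0 r) (V t))"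

definition piecewise_right_continuous ::
  "(nat \<Rightarrow> real) \<Rightarrow> (real \<Rightarrow> 'a::banach \<Rightarrow> real) \<Rightarrow> bool" where
  "piecewise_right_continuous \<sigma> V \<longleftrightarrow>
     (\<forall>x. (\<forall>k. continuous_on {\<sigma> k..<\<sigma> (Suc k)} (\<lambda>t. V t x)) \<and>
          (\<forall>t\<in>impulse_times \<sigma>. \<exists>l. ((\<lambda>\<tau>. V \<tau> x) \<longlongrightarrow> l) (at_left t)))"

definition lower_Dini ::
  "(real \<Rightarrow> 'a::banach \<Rightarrow>\<^sub>L 'a) \<Rightarrow> (real \<Rightarrow> 'a \<Rightarrow> real) \<Rightarrow> real \<Rightarrow> 'a \<Rightarrow> ereal" where
  "lower_Dini S V t x =
     Liminf (at_right 0) (\<lambda>h. ereal ((V (t + h) (S h x) - V t x) / h))"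

definition lyapunov_functional ::
  "(real \<Rightarrow> 'a::banach \<Rightarrow>\<^sub>L 'a) \<Rightarrow> ('a \<Rightarrow>\<^sub>L 'a) \<Rightarrow> (nat \<Rightarrow> real) \<Rightarrow> real \<Rightarrow> real \<Rightarrow>
     (real \<Rightarrow> 'a \<Rightarrow> real) \<Rightarrow> bool" where
  "lyapunov_functional S J \<sigma> p c V \<longleftrightarrow>
     (\<forall>t\<ge>0. \<forall>x. 0 \<le> V t x) \<and>
     lipschitz_on_bounded V \<and>
     piecewise_right_continuous \<sigma> V \<and>
     (\<forall>x. (\<forall>t\<ge>0. V t x \<le> c * norm x powr p) \<and>
          (\<forall>t\<ge>0. lower_Dini S V t x \<le> ereal (- (norm x powr p))) \<and>
          (\<forall>t\<in>impulse_times \<sigma>. V t (J x) - Lim (at_left t) (\<lambda>\<tau>. V \<tau> x) \<le> - (norm x powr p)))"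

text \<open>The integral and the sum are taken in \<open>[0, \<infinity>]\<close>, so that a finite bound on \<open>datko_cost\<close>
  includes convergence.\<close>

definition datko_cost ::
  "(real \<Rightarrow> 'a::banach \<Rightarrow>\<^sub>L 'a) \<Rightarrow> ('a \<Rightarrow>\<^sub>L 'a) \<Rightarrow> (nat \<Rightarrow> real) \<Rightarrow> real \<Rightarrow> real \<Rightarrow> 'a \<Rightarrow> ennreal" where
  "datko_cost S J \<sigma> p s x =
     (\<integral>\<^sup>+ t\<in>{s..}. ennreal (norm (propagator S J \<sigma> t s x) powr p) \<partial>lborel) +
     (\<Sum>\<^sub>\<infinity>k\<in>{k. 1 \<le> k \<and> s < \<sigma> k}. ennreal (norm (propagator_left S J \<sigma> (\<sigma> k) s x) powr p))"

end

theory Submission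
  imports Defs
begin

text \<open>The propagator \<open>U(t,s)\<close> is a two-parameter evolution family with two clocks: elapsed time \<open>t - s\<close> and the
  number \<open>\<kappa>(t,s)\<close> of impulses. The growth condition supplies a constant \<open>K\<close> with
  \<open>\<parallel>S(\<tau>)\<parallel> \<le> K\<close> for every \<open>\<tau>\<close> not longer than some interval between consecutive impulse times
  (\<open>growth_condition_imp_impulsive_system\<close>). Write \<open>V\<^sub>p(s,x)\<close> for the sum of the integral of
  \<open>\<parallel>U(t,s)x\<parallel>\<^sup>p\<close> over \<open>t \<ge> s\<close> and of the values \<open>\<parallel>U(t\<^sub>k\<^sup>-,s)x\<parallel>\<^sup>p\<close> at the later impulse times \<open>t\<^sub>k > s\<close>.

  Exponential decay in both clocks bounds \<open>V\<^sub>p\<close> by \<open>C \<parallel>x\<parallel>\<^sup>p\<close>: the integral is dominated by an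
  exponential, the sum by a geometric series (\<open>cost_le_of_decay\<close>).

  Such a bound already makes \<open>V\<^sub>p\<close> a Lyapunov functional (\<open>lyapunov_functional_cost\<close>). Splitting off
  an initial piece of the trajectory, \<open>V\<^sub>p(t,x)\<close> equals the integral of \<open>\<parallel>S(u)x\<parallel>\<^sup>p\<close> over
  \<open>[0,h]\<close> plus \<open>V\<^sub>p(t + h, S(h)x)\<close> within an interval free of impulses, and an impulse costs exactly
  \<open>\<parallel>x\<parallel>\<^sup>p\<close>; this yields the Dini derivative, the jump condition and the continuity in \<open>t\<close>.
  The Lipschitz bound in \<open>x\<close> is a consequence of convexity: \<open>V\<^sub>p(t,\<cdot>)\<close> is a convex function between
  \<open>0\<close> and \<open>C \<parallel>x\<parallel>\<^sup>p\<close>, and a bounded convex function is Lipschitz on smaller balls.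

  Conversely, integrating the Dini inequality of any Lyapunov functional \<open>V\<close> along a trajectory
  and adding up the jump conditions shows that \<open>V\<close> decreases at least by the cost incurred,
  so \<open>V\<^sub>p \<le> V\<close> (\<open>cost_le_lyapunov\<close>).

  Finally, a bound \<open>V\<^sub>p(s,x) \<le> b\<^sup>p \<parallel>x\<parallel>\<^sup>p\<close> forces exponential decay by an argument of Datko type
  (\<open>propagator_decay_of_cost_bound\<close>). Each single term of the sum is bounded, so the state after
  any impulse is bounded by a multiple of \<open>\<parallel>x\<parallel>\<close>, and \<open>K\<close> bounds the flow until the next one; hence \<open>U\<close> is
  uniformly bounded. Therefore \<open>\<parallel>U(t,s)x\<parallel>\<close> is, up to a constant, a lower bound for the norm of the
  state at all earlier times, and the cost is at least a multiple of
  \<open>\<theta>(t,s) \<parallel>U(t,s)x\<parallel>\<^sup>p\<close> with \<open>\<theta>(t,s) = (t - s) + \<kappa>(t,s)\<close>. So \<open>\<parallel>U(t,s)\<parallel> \<le> 1/2\<close> as soon as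
  \<open>\<theta>(t,s)\<close> is large, and iterating this gives decay that is exponential in \<open>\<theta>\<close>,
  that is, in both clocks at once.\<close>

section \<open>Auxiliary facts on lists, convexity and real functions\<close>

lemma sorted_list_of_set_Un_append:
  fixes P Q :: "'b::linorder set"
  assumes "finite P" "finite Q" "\<And>p q. p \<in> P \<Longrightarrow> q \<in> Q \<Longrightarrow> p < q"
  shows "sorted_list_of_set (P \<union> Q) = sorted_list_of_set P @ sorted_list_of_set Q"
proof (rule sorted_list_of_set_unique[THEN iffD1])
  show "finite (P \<union> Q)" using assms by simp
  have "P \<inter> Q = {}" using assms(3) by fastforce
  then show "sorted_wrt (<) (sorted_list_of_set P @ sorted_list_of_set Q) \<and>
      set (sorted_list_of_set P @ sorted_list_of_set Q) = P \<union> Q \<and>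
      length (sorted_list_of_set P @ sorted_list_of_set Q) = card (P \<union> Q)"
    using assms by (simp add: sorted_wrt_append card_Un_disjoint)
qed

lemma convex_combination_powr_le:
  fixes a b u v p :: real
  assumes "1 \<le> p" "0 \<le> a" "0 \<le> b" "0 \<le> u" "0 \<le> v" "u + v = 1"
  shows "(u * a + v * b) powr p \<le> u * a powr p + v * b powr p"
proof -
  have scale: "(w * c) powr p \<le> w * c powr p" if "0 \<le> w" "w \<le> 1" "0 \<le> c" for w c :: real
  proof -
    have "w powr p \<le> w"
      using powr_mono'[of 1 p w] that assms(1) by simp
    then show ?thesis
      using that by (simp add: powr_mult mult_right_mono)
  qed
  consider "a = 0" | "b = 0" | "0 < a" "0 < b"
    using assms by fastforce
  then show ?thesis
  proof cases
    case 1
    then show ?thesis using scale[of v b] assms by simp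
  next
    case 2
    then show ?thesis using scale[of u a] assms by simp
  next
    case 3
    have "u = 1 - v" using assms(6) by simp
    then show ?thesis
      using convex_onD[OF powr_convex[OF assms(1)], of v a b] 3 assms(5) assms(4)
      unfolding \<open>u = 1 - v\<close> by simp
  qed
qed

lemma powr_le_imp_le:
  fixes a b p :: real
  assumes "a powr p \<le> b powr p" "0 < p" "0 \<le> b"
  shows "a \<le> b"
proof (rule ccontr)
  assume "\<not> a \<le> b"
  then have "b powr p < a powr p"
    using assms by (intro powr_less_mono2) auto
  with assms(1) show False by simp
qed

text \<open>Prolong the segment from \<open>x\<close> to \<open>y\<close> by the length \<open>r\<close> to a point \<open>z\<close> of the larger ball. Convexity bounds
  the slope from \<open>x\<close> to \<open>y\<close> by the slope from \<open>x\<close> to \<open>z\<close>, which is at most \<open>B / r\<close>.\<close>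

lemma convex_bounded_imp_lipschitz_on:
  fixes f :: "'b::real_normed_vector \<Rightarrow> real"
  assumes "convex_on UNIV f" "0 < r"
    and bounds: "\<And>x. norm x < 2 * r \<Longrightarrow> 0 \<le> f x \<and> f x \<le> B"
  shows "(B / r)-lipschitz_on (ball 0 r) f"
proof (rule lipschitz_onI)
  have B: "0 \<le> B"
    using bounds[of 0] assms(2) by auto
  then show "0 \<le> B / r" using assms(2) by simp
  have le: "f y - f x \<le> B / r * norm (y - x)" if x: "norm x < r" and y: "norm y < r" for x y
  proof (cases "x = y")
    case False
    define d where "d = norm (y - x)"
    have d: "0 < d" using False by (simp add: d_def)
    define z where "z = y + (r / d) *\<^sub>R (y - x)"
    define w where "w = d / (r + d)"
    have w: "0 \<le> w" "w \<le> 1" "w \<le> d / r"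
      using d assms(2) by (auto simp: w_def frac_le)
    have "norm z \<le> norm y + norm ((r / d) *\<^sub>R (y - x))"
      unfolding z_def by (rule norm_triangle_ineq)
    also have "norm ((r / d) *\<^sub>R (y - x)) = r"
      using d assms(2) by (simp flip: d_def)
    finally have z: "norm z < 2 * r" using y by simp
    have comb: "y = (1 - w) *\<^sub>R x + w *\<^sub>R z"
    proof -
      have "w * (r / d) = 1 - w"
        using d assms(2) by (simp add: w_def field_simps)
      then have "(1 - w) *\<^sub>R x + w *\<^sub>R z = (1 - w) *\<^sub>R x + w *\<^sub>R y + (1 - w) *\<^sub>R (y - x)"
        by (simp add: z_def scaleR_add_right)
      then show ?thesis by (simp add: algebra_simps)
    qed
    have "f y \<le> (1 - w) * f x + w * f z"
      using convex_onD[OF assms(1), of w x z] w comb by simp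
    then have "f y - f x \<le> w * f z - w * f x"
      by (simp add: algebra_simps)
    also have "\<dots> \<le> w * B"
      using w bounds[of z] bounds[of x] x z assms(2) mult_left_mono[of "f z" B w] mult_nonneg_nonneg[of w "f x"]
      by linarith
    also have "\<dots> \<le> d / r * B"
      using w B by (intro mult_right_mono) auto
    finally show ?thesis by (simp add: d_def mult.commute)
  qed simp
  fix x y :: 'b assume "x \<in> ball 0 r" "y \<in> ball 0 r"
  then show "dist (f x) (f y) \<le> B / r * dist x y"
    using le[of x y] le[of y x] by (auto simp: dist_norm norm_minus_commute abs_le_iff)
qed

text \<open>Because the Lipschitz constants do not depend on time, a moving argument \<open>z \<tau> \<rightarrow> y\<close> may be replaced by its
  limit. The lemma serves for continuity along trajectories and for left limits at impulse times.\<close>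

lemma lipschitz_on_bounded_tendsto:
  assumes V: "lipschitz_on_bounded V"
    and z: "(z \<longlongrightarrow> y) F"
    and v: "((\<lambda>\<tau>. V (g \<tau>) y) \<longlongrightarrow> v) F"
    and g: "\<forall>\<^sub>F \<tau> in F. 0 \<le> g \<tau>"
  shows "((\<lambda>\<tau>. V (g \<tau>) (z \<tau>)) \<longlongrightarrow> v) F"
proof -
  define r where "r = norm y + 1"
  have "0 < r" by (simp add: r_def add_nonneg_pos)
  then obtain L where L: "\<And>t. 0 \<le> t \<Longrightarrow> L-lipschitz_on (ball 0 r) (V t)"
    using V unfolding lipschitz_on_bounded_def by blast
  have "\<forall>\<^sub>F \<tau> in F. dist (z \<tau>) y < 1"
    using z by (rule tendstoD) simp
  then have bound: "\<forall>\<^sub>F \<tau> in F. norm (V (g \<tau>) (z \<tau>) - V (g \<tau>) y) \<le> L * dist (z \<tau>) y"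
    using g
  proof eventually_elim
    case (elim \<tau>)
    have "norm (z \<tau>) \<le> norm y + dist (z \<tau>) y"
      using norm_triangle_ineq[of y "z \<tau> - y"] by (simp add: dist_norm)
    then show ?case
      using lipschitz_onD[OF L[OF elim(2)], of "z \<tau>" y] elim(1) by (simp add: r_def dist_norm)
  qed
  have "((\<lambda>\<tau>. L * dist (z \<tau>) y) \<longlongrightarrow> 0) F"
    using tendsto_dist[OF z tendsto_const[of y]] by (intro tendsto_mult_right_zero) simp
  then have "((\<lambda>\<tau>. V (g \<tau>) (z \<tau>) - V (g \<tau>) y) \<longlongrightarrow> 0) F"
    by (rule Lim_null_comparison[OF bound])
  from tendsto_add[OF this v] show ?thesis by simp
qed

text \<open>The last point of \<open>[a,c]\<close> at which \<open>\<psi> \<le> \<psi> a\<close> can only be \<open>c\<close>, since from any earlier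
  one some forward step stays below. A single step suffices at each point, which is what a
  lower Dini derivative provides.\<close>

lemma le_of_local_descent:
  fixes \<psi> :: "real \<Rightarrow> real"
  assumes "a \<le> c" "continuous_on {a..c} \<psi>"
    and descent: "\<And>t. a \<le> t \<Longrightarrow> t < c \<Longrightarrow> \<exists>h>0. t + h \<le> c \<and> \<psi> (t + h) \<le> \<psi> t"
  shows "\<psi> c \<le> \<psi> a"
proof -
  define E where "E = {t \<in> {a..c}. \<psi> t \<le> \<psi> a}"
  have "closed E"
    using continuous_closed_preimage[OF assms(2) closed_atLeastAtMost closed_atMost[of "\<psi> a"]]
    by (simp add: E_def vimage_def Int_def)
  then have "compact ({a..c} \<inter> E)"
    by (intro compact_Int_closed) auto
  moreover have "{a..c} \<inter> E = E"
    by (auto simp: E_def)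
  moreover have "a \<in> E"
    using assms(1) by (simp add: E_def)
  ultimately obtain t where t: "t \<in> E" "\<And>u. u \<in> E \<Longrightarrow> u \<le> t"
    using compact_attains_sup[of E] by auto
  have "\<not> t < c"
  proof
    assume "t < c"
    then obtain h where "0 < h" "t + h \<le> c" "\<psi> (t + h) \<le> \<psi> t"
      using descent[of t] t(1) by (auto simp: E_def)
    then have "t + h \<in> E"
      using t(1) by (auto simp: E_def)
    then show False
      using t(2)[of "t + h"] \<open>0 < h\<close> by simp
  qed
  then show ?thesis
    using t(1) by (auto simp: E_def)
qed

section \<open>Impulse sequences\<close>

locale impulse_sequence =
  fixes \<sigma> :: "nat \<Rightarrow> real"
  assumes impulse_sequence: "\<sigma> \<in> impulse_sequences"
begin

lemma sigma_0: "\<sigma> 0 = 0"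
  and strict_mono_sigma: "strict_mono \<sigma>"
  and sigma_at_top: "filterlim \<sigma> at_top sequentially"
  using impulse_sequence by (auto simp: impulse_sequences_def)

lemma sigma_less_iff [simp]: "\<sigma> i < \<sigma> j \<longleftrightarrow> i < j"
  using strict_mono_sigma by (rule strict_mono_less)

lemma sigma_le_iff [simp]: "\<sigma> i \<le> \<sigma> j \<longleftrightarrow> i \<le> j"
  using strict_mono_sigma by (rule strict_mono_less_eq)

lemma sigma_nonneg [simp]: "0 \<le> \<sigma> k"
  using sigma_le_iff[of 0 k] by (simp add: sigma_0)

lemma sigma_unbounded: "\<exists>n. t < \<sigma> n"
  using sigma_at_top by (auto simp: filterlim_at_top_dense eventually_sequentially)

lemma dwell_index:
  assumes "0 \<le> s"
  obtains l where "\<sigma> l \<le> s" "s < \<sigma> (Suc l)"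
proof -
  define n where "n = (LEAST n. s < \<sigma> n)"
  have n: "s < \<sigma> n"
    unfolding n_def using sigma_unbounded by (rule LeastI_ex)
  then obtain l where l: "n = Suc l"
    using assms by (cases n) (auto simp: sigma_0)
  moreover have "\<not> s < \<sigma> l"
    using not_less_Least[of l "\<lambda>n. s < \<sigma> n"] l unfolding n_def by simp
  ultimately show thesis
    using n that[of l] by simp
qed

lemma dwell_less_iff:
  assumes "\<sigma> l \<le> s" "s < \<sigma> (Suc l)"
  shows "s < \<sigma> k \<longleftrightarrow> l < k"
proof
  show "l < k" if "s < \<sigma> k"
    using assms(1) that sigma_less_iff[of l k] by linarith
  show "s < \<sigma> k" if "l < k"
    using assms(2) that sigma_le_iff[of "Suc l" k] by linarith
qed

lemma impulses_between:
  assumes "\<sigma> l \<le> s" "s < \<sigma> (Suc l)" "\<sigma> m \<le> t" "t < \<sigma> (Suc m)"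
  shows "impulse_times \<sigma> \<inter> {s<..t} = \<sigma> ` {l<..m}"
  using dwell_less_iff[OF assms(1,2)] dwell_less_iff[OF assms(3,4)]
  by (auto simp: impulse_times_def not_less[symmetric])

lemma finite_impulses: "finite (impulse_times \<sigma> \<inter> {s<..t})"
proof -
  obtain n where n: "t < \<sigma> n"
    using sigma_unbounded by blast
  have "impulse_times \<sigma> \<inter> {s<..t} \<subseteq> \<sigma> ` {..<n}"
  proof
    fix r assume "r \<in> impulse_times \<sigma> \<inter> {s<..t}"
    then obtain k where "r = \<sigma> k" "\<sigma> k < \<sigma> n"
      using n by (force simp: impulse_times_def simp del: sigma_less_iff)
    then show "r \<in> \<sigma> ` {..<n}" by auto
  qed
  then show ?thesis
    by (rule finite_subset) simp
qed

lemma impulse_count_eq: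
  assumes "\<sigma> l \<le> s" "s < \<sigma> (Suc l)" "\<sigma> m \<le> t" "t < \<sigma> (Suc m)"
  shows "impulse_count \<sigma> t s = m - l"
proof -
  have "inj \<sigma>"
    using strict_mono_sigma by (rule strict_mono_imp_inj_on)
  then show ?thesis
    unfolding impulse_count_def impulses_between[OF assms]
    using card_image[OF inj_on_subset[OF \<open>inj \<sigma>\<close> subset_UNIV]] by simp
qed

lemma impulse_count_add:
  assumes "s \<le> r" "r \<le> t"
  shows "impulse_count \<sigma> t s = impulse_count \<sigma> r s + impulse_count \<sigma> t r"
proof -
  have "impulse_times \<sigma> \<inter> {s<..t} = (impulse_times \<sigma> \<inter> {s<..r}) \<union> (impulse_times \<sigma> \<inter> {r<..t})"
    using assms by auto
  moreover have "card ((impulse_times \<sigma> \<inter> {s<..r}) \<union> (impulse_times \<sigma> \<inter> {r<..t})) =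
      card (impulse_times \<sigma> \<inter> {s<..r}) + card (impulse_times \<sigma> \<inter> {r<..t})"
    by (intro card_Un_disjoint finite_impulses) auto
  ultimately show ?thesis
    unfolding impulse_count_def by (simp only:)
qed

end

section \<open>The propagator\<close>

lemma blinfun_compose_assoc': "(A o\<^sub>L B) o\<^sub>L C = A o\<^sub>L (B o\<^sub>L C)"
  for A :: "'c::real_normed_vector \<Rightarrow>\<^sub>L 'd::real_normed_vector"
    and B :: "'b::real_normed_vector \<Rightarrow>\<^sub>L 'c" and C :: "'e::real_normed_vector \<Rightarrow>\<^sub>L 'b"
  by (rule blinfun_eqI) simp

text \<open>The bound \<open>K\<close> for flows that fit into some dwell interval \<open>[\<sigma> k, \<sigma> (Suc k)]\<close> is how the growth condition
  enters the arguments below; one constant serves all intervals, however long they are.\<close>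

locale impulsive_system = impulse_sequence \<sigma>
  for \<sigma> :: "nat \<Rightarrow> real" +
  fixes S :: "real \<Rightarrow> 'a::banach \<Rightarrow>\<^sub>L 'a" and J :: "'a \<Rightarrow>\<^sub>L 'a" and K :: real
  assumes semigroup: "C0_semigroup S"
    and K_ge_1: "1 \<le> K"
    and dwell_bound: "\<And>k \<tau>. 0 \<le> \<tau> \<Longrightarrow> \<tau> \<le> \<sigma> (Suc k) - \<sigma> k \<Longrightarrow> norm (S \<tau>) \<le> K"
begin

abbreviation U :: "real \<Rightarrow> real \<Rightarrow> 'a \<Rightarrow>\<^sub>L 'a"
  where "U \<equiv> propagator S J \<sigma>"

abbreviation U_left :: "real \<Rightarrow> real \<Rightarrow> 'a \<Rightarrow> 'a"
  where "U_left \<equiv> propagator_left S J \<sigma>"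

abbreviation cost :: "real \<Rightarrow> real \<Rightarrow> 'a \<Rightarrow> ennreal"
  where "cost \<equiv> datko_cost S J \<sigma>"

lemma S_0 [simp]: "S 0 = id_blinfun"
  using semigroup by (simp add: C0_semigroup_def)

lemma S_add: "0 \<le> t \<Longrightarrow> 0 \<le> s \<Longrightarrow> S (t + s) = S t o\<^sub>L S s"
  using semigroup by (simp add: C0_semigroup_def)

lemma S_diff:
  assumes "s \<le> r" "r \<le> t"
  shows "S (t - s) = S (t - r) o\<^sub>L S (r - s)"
  using S_add[of "t - r" "r - s"] assms by simp

lemma flow_along_restart:
  assumes "s \<le> r" "r \<le> t" "\<And>y. y \<in> set ys \<Longrightarrow> r \<le> y"
  shows "flow_along S J t s ys = flow_along S J t r ys o\<^sub>L S (r - s)"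
proof (cases ys)
  case Nil
  then show ?thesis using S_diff[OF assms(1,2)] by simp
next
  case (Cons y zs)
  then show ?thesis
    using S_diff[of s r y] assms by (simp add: blinfun_compose_assoc')
qed

text \<open>This is the cocycle property on the level of impulse lists; the base case restarts the flow at the
  intermediate time \<open>r\<close>.\<close>

lemma flow_along_append:
  assumes "s \<le> r" "r \<le> t" "sorted xs" "\<And>y. y \<in> set xs \<Longrightarrow> s \<le> y \<and> y \<le> r"
    "\<And>y. y \<in> set ys \<Longrightarrow> r \<le> y"
  shows "flow_along S J t s (xs @ ys) = flow_along S J t r ys o\<^sub>L flow_along S J r s xs"
  using assms(1,3,4)
proof (induction xs arbitrary: s)
  case Nil
  then show ?case
    using flow_along_restart[of s r t ys] assms(2,5) by simp
next
  case (Cons x xs)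
  then show ?case by (simp add: blinfun_compose_assoc')
qed

lemma propagator_cocycle:
  assumes "s \<le> r" "r \<le> t"
  shows "U t s = U t r o\<^sub>L U r s"
proof -
  have "impulse_times \<sigma> \<inter> {s<..t} = (impulse_times \<sigma> \<inter> {s<..r}) \<union> (impulse_times \<sigma> \<inter> {r<..t})"
    using assms by auto
  moreover have "sorted_list_of_set ((impulse_times \<sigma> \<inter> {s<..r}) \<union> (impulse_times \<sigma> \<inter> {r<..t})) =
      sorted_list_of_set (impulse_times \<sigma> \<inter> {s<..r}) @ sorted_list_of_set (impulse_times \<sigma> \<inter> {r<..t})"
    by (rule sorted_list_of_set_Un_append[OF finite_impulses finite_impulses]) simp
  moreover have "flow_along S J t s
      (sorted_list_of_set (impulse_times \<sigma> \<inter> {s<..r}) @ sorted_list_of_set (impulse_times \<sigma> \<inter> {r<..t})) =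
      U t r o\<^sub>L U r s"
    unfolding propagator_def
  proof (rule flow_along_append[OF assms])
  qed (simp_all add: finite_impulses)
  ultimately show ?thesis
    unfolding propagator_def[of S J \<sigma> t s] by (simp only:)
qed

lemma propagator_cocycle_apply:
  "s \<le> r \<Longrightarrow> r \<le> t \<Longrightarrow> U t s x = U t r (U r s x)"
  using propagator_cocycle[of s r t] by simp

lemma propagator_refl [simp]: "U s s = id_blinfun"
  by (simp add: propagator_def)

lemma propagator_dwell:
  assumes "\<sigma> l \<le> s" "s \<le> t" "t < \<sigma> (Suc l)"
  shows "U t s = S (t - s)"
  using impulses_between[of l s l t] assms by (simp add: propagator_def)

lemma propagator_within_dwell:
  assumes "s \<le> r" "\<sigma> m \<le> r" "r \<le> t" "t < \<sigma> (Suc m)"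
  shows "U t s x = S (t - r) (U r s x)"
  using propagator_cocycle_apply[of s r t x] propagator_dwell[of m r t] assms by simp

lemma propagator_jump:
  assumes "\<sigma> l \<le> s" "s < \<sigma> (Suc l)"
  shows "U (\<sigma> (Suc l)) s x = J (S (\<sigma> (Suc l) - s) x)"
proof -
  have "impulse_times \<sigma> \<inter> {s<..\<sigma> (Suc l)} = {\<sigma> (Suc l)}"
    using impulses_between[of l s "Suc l" "\<sigma> (Suc l)"] assms
    by (simp add: atLeastSucAtMost_greaterThanAtMost[symmetric])
  then show ?thesis by (simp add: propagator_def)
qed

text \<open>Strong continuity at \<open>0\<close> spreads to a whole dwell interval because \<open>S b - S a = S a (S (b - a) - 1)\<close>
  for \<open>a \<le> b\<close>, and \<open>S a\<close> is bounded by \<open>K\<close> there; restricting to that interval avoids the uniform boundedness principle.\<close>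

lemma continuous_on_S:
  "continuous_on {0..\<sigma> (Suc l) - \<sigma> l} (\<lambda>\<tau>. S \<tau> x)"
proof -
  let ?T = "\<sigma> (Suc l) - \<sigma> l"
  have shift: "norm (S b x - S a x) \<le> K * norm (S (b - a) x - x)"
    if "0 \<le> a" "a \<le> b" "b \<le> ?T" for a b
  proof -
    have "S b = S a o\<^sub>L S (b - a)"
      using S_add[of a "b - a"] that by simp
    then have "S b x - S a x = S a (S (b - a) x - x)"
      by (simp add: blinfun.diff_right)
    then have "norm (S b x - S a x) \<le> norm (S a) * norm (S (b - a) x - x)"
      using norm_blinfun by metis
    also have "\<dots> \<le> K * norm (S (b - a) x - x)"
      using that dwell_bound[of a l] by (intro mult_right_mono) auto
    finally show ?thesis .
  qed
  show ?thesis
    unfolding continuous_on_iff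
  proof (intro ballI allI impI)
    fix a :: real and e :: real
    assume a: "a \<in> {0..?T}" and "0 < e"
    have "((\<lambda>t. S t x) \<longlongrightarrow> x) (at_right 0)"
      using semigroup by (simp add: C0_semigroup_def)
    then have "eventually (\<lambda>h. dist (S h x) x < e / K) (at_right 0)"
      using \<open>0 < e\<close> K_ge_1 by (intro tendstoD) auto
    then obtain d where d: "0 < d" "\<And>h. 0 < h \<Longrightarrow> h < d \<Longrightarrow> norm (S h x - x) < e / K"
      unfolding eventually_at_right_field dist_norm by auto
    have small: "norm (S b x - S a x) < e" if "0 \<le> a" "a \<le> b" "b \<le> ?T" "b - a < d" for a b
    proof (cases "a = b")
      case False
      then have "K * norm (S (b - a) x - x) < K * (e / K)"
        using that d(2)[of "b - a"] K_ge_1 by (intro mult_strict_left_mono) auto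
      then show ?thesis
        using shift[OF that(1-3)] K_ge_1 by simp
    qed (use \<open>0 < e\<close> in simp)
    have "dist (S b x) (S a x) < e" if "b \<in> {0..?T}" "dist b a < d" for b
    proof (cases "a \<le> b")
      case True
      then show ?thesis using small[of a b] that a by (simp add: dist_norm)
    next
      case False
      then show ?thesis
        using small[of b a] that a by (simp add: dist_norm norm_minus_commute)
    qed
    with d(1) show "\<exists>d>0. \<forall>b\<in>{0..?T}. dist b a < d \<longrightarrow> dist (S b x) (S a x) < e"
      by blast
  qed
qed

lemma continuous_on_S_shift:
  assumes "\<sigma> l \<le> s"
  shows "continuous_on {s..\<sigma> (Suc l)} (\<lambda>t. S (t - s) x)"
proof (rule continuous_on_compose2[OF continuous_on_S[of l x], of _ "\<lambda>t. t - s"])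
  show "continuous_on {s..\<sigma> (Suc l)} (\<lambda>t. t - s)"
    by (intro continuous_intros)
qed (use assms in auto)

lemma left_limit_S:
  assumes "\<sigma> l \<le> s" "s < \<sigma> (Suc l)"
  shows "((\<lambda>t. S (t - s) x) \<longlongrightarrow> S (\<sigma> (Suc l) - s) x) (at_left (\<sigma> (Suc l)))"
proof -
  let ?b = "\<sigma> (Suc l)"
  have "?b \<in> {s..?b}"
    using assms(2) by simp
  with continuous_on_S_shift[OF assms(1), of x]
  have "((\<lambda>t. S (t - s) x) \<longlongrightarrow> S (?b - s) x) (at ?b within {s..?b})"
    by (auto simp only: continuous_on_def)
  then show ?thesis
    by (simp only: at_within_Icc_at_left[OF assms(2)])
qed

lemma propagator_tendsto_left:
  assumes "0 \<le> s" "s \<le> r" "\<sigma> m \<le> r" "r < \<sigma> (Suc m)"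
  shows "((\<lambda>t. U t s x) \<longlongrightarrow> S (\<sigma> (Suc m) - r) (U r s x)) (at_left (\<sigma> (Suc m)))"
proof (rule Lim_transform_eventually[OF left_limit_S[OF assms(3,4)]])
  show "\<forall>\<^sub>F t in at_left (\<sigma> (Suc m)). S (t - r) (U r s x) = U t s x"
    using eventually_at_left_real[OF assms(4)]
  proof eventually_elim
    case (elim t)
    then show ?case
      using propagator_within_dwell[of s r m t x] assms by simp
  qed
qed

lemma propagator_left_eq:
  assumes "0 \<le> s" "s \<le> r" "\<sigma> m \<le> r" "r < \<sigma> (Suc m)"
  shows "U_left (\<sigma> (Suc m)) s x = S (\<sigma> (Suc m) - r) (U r s x)"
  unfolding propagator_left_def
  by (rule tendsto_Lim[OF _ propagator_tendsto_left[OF assms]]) simp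

lemma propagator_left_dwell:
  assumes "\<sigma> l \<le> s" "s < \<sigma> (Suc l)"
  shows "U_left (\<sigma> (Suc l)) s x = S (\<sigma> (Suc l) - s) x"
  using propagator_left_eq[of s s l x] assms sigma_nonneg[of l] by simp

lemma propagator_tendsto_propagator_left:
  assumes "0 \<le> s" "s < \<sigma> (Suc m)"
  shows "((\<lambda>t. U t s x) \<longlongrightarrow> U_left (\<sigma> (Suc m)) s x) (at_left (\<sigma> (Suc m)))"
  using propagator_tendsto_left[of s "max s (\<sigma> m)" m x]
    propagator_left_eq[of s "max s (\<sigma> m)" m x] assms by simp

lemma propagator_left_cocycle:
  assumes "0 \<le> s" "s \<le> r" "r < \<sigma> (Suc m)"
  shows "U_left (\<sigma> (Suc m)) s x = U_left (\<sigma> (Suc m)) r (U r s x)"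
  using propagator_left_eq[of s "max r (\<sigma> m)" m x] propagator_left_eq[of r "max r (\<sigma> m)" m "U r s x"]
    assms propagator_cocycle_apply[of s r "max r (\<sigma> m)" x] by simp

lemma propagator_jump_left:
  assumes "0 \<le> s" "s < \<sigma> (Suc m)"
  shows "U (\<sigma> (Suc m)) s x = J (U_left (\<sigma> (Suc m)) s x)"
proof -
  let ?r = "max s (\<sigma> m)"
  have "U (\<sigma> (Suc m)) s x = U (\<sigma> (Suc m)) ?r (U ?r s x)"
    using assms by (intro propagator_cocycle_apply) auto
  then show ?thesis
    using propagator_jump[of m ?r] propagator_left_eq[of s ?r m x] assms by simp
qed

text \<open>The state is continuous on each of the countably many intervals between impulse times.\<close>

lemma borel_measurable_propagator:
  assumes "0 \<le> s"
  shows "(\<lambda>t. ennreal (norm (U t s x) powr p) * indicator {s..} t) \<in> borel_measurable borel"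
proof (rule measurable_piecewise_restrict[where C = "insert {..<s} (range (\<lambda>k. {\<sigma> k..<\<sigma> (Suc k)} \<inter> {s..}))"])
  show "space borel \<subseteq> \<Union> (insert {..<s} (range (\<lambda>k. {\<sigma> k..<\<sigma> (Suc k)} \<inter> {s..})))"
  proof
    fix t :: real
    show "t \<in> \<Union> (insert {..<s} (range (\<lambda>k. {\<sigma> k..<\<sigma> (Suc k)} \<inter> {s..})))"
    proof (cases "t < s")
      case False
      then obtain k where "\<sigma> k \<le> t" "t < \<sigma> (Suc k)"
        using assms dwell_index[of t] by auto
      then show ?thesis using False by auto
    qed auto
  qed
  fix \<Omega> assume "\<Omega> \<in> insert {..<s} (range (\<lambda>k. {\<sigma> k..<\<sigma> (Suc k)} \<inter> {s..}))"
  then consider "\<Omega> = {..<s}" | k where "\<Omega> = {\<sigma> k..<\<sigma> (Suc k)} \<inter> {s..}" by auto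
  then show "(\<lambda>t. ennreal (norm (U t s x) powr p) * indicator {s..} t)
      \<in> borel_measurable (restrict_space borel \<Omega>)"
  proof cases
    case 1
    have "(\<lambda>t. 0 :: ennreal) \<in> borel_measurable (restrict_space borel \<Omega>)" by simp
    then show ?thesis
      by (rule measurable_cong[THEN iffD1, rotated]) (auto simp: 1 space_restrict_space)
  next
    case (2 k)
    let ?r = "max s (\<sigma> k)"
    have "continuous_on \<Omega> (\<lambda>t. S (t - ?r) (U ?r s x))"
      by (rule continuous_on_subset[OF continuous_on_S_shift[of k]]) (auto simp: 2)
    then have "continuous_on \<Omega> (\<lambda>t. norm (S (t - ?r) (U ?r s x)))"
      by (rule continuous_on_norm)
    then have "(\<lambda>t. norm (S (t - ?r) (U ?r s x))) \<in> borel_measurable (restrict_space borel \<Omega>)"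
      by (rule borel_measurable_continuous_on_restrict)
    then have "(\<lambda>t. ennreal (norm (S (t - ?r) (U ?r s x)) powr p)) \<in> borel_measurable (restrict_space borel \<Omega>)"
      by measurable
    then show ?thesis
    proof (rule measurable_cong[THEN iffD1, rotated])
      fix t assume "t \<in> space (restrict_space borel \<Omega>)"
      then have "s \<le> t" "\<sigma> k \<le> t" "t < \<sigma> (Suc k)"
        by (auto simp: 2 space_restrict_space)
      then show "ennreal (norm (S (t - ?r) (U ?r s x)) powr p) =
          ennreal (norm (U t s x) powr p) * indicator {s..} t"
        using propagator_within_dwell[of s ?r k t x] by simp
    qed
  qed
qed auto

lemma borel_measurable_propagator_on:
  assumes "0 \<le> s" "B \<in> sets borel" "B \<subseteq> {s..}"
  shows "(\<lambda>t. ennreal (norm (U t s x) powr p) * indicator B t) \<in> borel_measurable lborel"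
proof -
  have "(\<lambda>t. (ennreal (norm (U t s x) powr p) * indicator {s..} t) * indicator B t) \<in> borel_measurable lborel"
    using borel_measurable_propagator[OF assms(1), of x p] assms(2) by simp
  then show ?thesis
    by (rule measurable_cong[THEN iffD1, rotated]) (use assms(3) in \<open>auto split: split_indicator\<close>)
qed

end

section \<open>The cost functional\<close>

context impulsive_system
begin

text \<open>The continuous part of the cost over an impulse-free stretch of length \<open>\<tau>\<close>. It depends on the
  length only, not on the starting time.\<close>

definition flow_energy :: "real \<Rightarrow> 'a \<Rightarrow> real \<Rightarrow> real"
  where "flow_energy p x \<tau> = integral {0..\<tau>} (\<lambda>u. norm (S u x) powr p)"

lemma flow_energy_0 [simp]: "flow_energy p x 0 = 0"
  by (simp add: flow_energy_def)

lemma flow_energy_nonneg: "0 \<le> flow_energy p x \<tau>"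
  unfolding flow_energy_def
  by (cases "(\<lambda>u. norm (S u x) powr p) integrable_on {0..\<tau>}")
    (auto intro: integral_nonneg simp: not_integrable_integral)

lemma continuous_on_norm_S_powr:
  assumes "1 \<le> p"
  shows "continuous_on {0..\<sigma> (Suc l) - \<sigma> l} (\<lambda>\<tau>. norm (S \<tau> x) powr p)"
  using assms by (intro continuous_on_powr' continuous_on_norm continuous_on_S continuous_on_const) auto

lemma flow_energy_has_derivative:
  assumes "1 \<le> p" "0 \<le> \<tau>" "\<tau> \<le> \<sigma> (Suc l) - \<sigma> l"
  shows "(flow_energy p x has_real_derivative norm (S \<tau> x) powr p)
    (at \<tau> within {0..\<sigma> (Suc l) - \<sigma> l})"
  unfolding flow_energy_def
  using integral_has_real_derivative[OF continuous_on_norm_S_powr[OF assms(1), of l x], of \<tau>] assms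
  by simp

lemma flow_energy_right_derivative:
  assumes "1 \<le> p" "0 \<le> \<tau>" "\<tau> < \<sigma> (Suc l) - \<sigma> l"
  shows "((\<lambda>h. (flow_energy p x (h + \<tau>) - flow_energy p x \<tau>) / h) \<longlongrightarrow> norm (S \<tau> x) powr p) (at_right 0)"
proof -
  let ?T = "\<sigma> (Suc l) - \<sigma> l"
  have "(flow_energy p x has_real_derivative norm (S \<tau> x) powr p) (at \<tau> within {0..?T})"
    by (rule flow_energy_has_derivative[OF assms(1,2)]) (use assms(3) in simp)
  then have "(flow_energy p x has_real_derivative norm (S \<tau> x) powr p) (at \<tau> within {\<tau>..?T})"
    by (rule DERIV_subset) (use assms(2) in auto)
  then have "((\<lambda>u. (flow_energy p x u - flow_energy p x \<tau>) / (u - \<tau>)) \<longlongrightarrow> norm (S \<tau> x) powr p) (at_right \<tau>)"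
    unfolding at_within_Icc_at_right[OF assms(3)] has_field_derivative_iff .
  then show ?thesis
    by (simp add: filterlim_at_right_to_0[where a = \<tau>])
qed

lemma continuous_on_flow_energy:
  assumes "1 \<le> p"
  shows "continuous_on {0..\<sigma> (Suc l) - \<sigma> l} (flow_energy p x)"
  by (rule DERIV_continuous_on[OF flow_energy_has_derivative]) (use assms in auto)

lemma nn_integral_within_dwell:
  assumes "1 \<le> p" "\<sigma> l \<le> s" "s \<le> r" "r \<le> \<sigma> (Suc l)"
  shows "(\<integral>\<^sup>+ t\<in>{s..<r}. ennreal (norm (U t s x) powr p) \<partial>lborel) =
    ennreal (flow_energy p x (r - s))"
proof -
  let ?f = "\<lambda>t. norm (S (t - s) x) powr p"
  have "continuous_on {0..r - s} (\<lambda>u. norm (S u x) powr p)"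
    by (rule continuous_on_subset[OF continuous_on_norm_S_powr[OF assms(1), of l]]) (use assms in auto)
  then have "((\<lambda>u. norm (S u x) powr p) has_integral flow_energy p x (r - s)) {0..r - s}"
    unfolding flow_energy_def by (intro integrable_integral integrable_continuous_interval)
  from has_integral_shift_real_ivl[OF this, of "- s"]
  have "(?f has_integral flow_energy p x (r - s)) {s..r}"
    by simp
  then have "(?f has_integral flow_energy p x (r - s)) {s..<r}"
  proof (rule has_integral_spike_set_eq[THEN iffD1, rotated 2])
    show "negligible {t \<in> {s..r} - {s..<r}. ?f t \<noteq> 0}"
      by (rule negligible_subset[of "{r}"]) auto
    show "negligible {t \<in> {s..<r} - {s..r}. ?f t \<noteq> 0}"
      by (rule negligible_subset[of "{}"]) auto
  qed
  then have "(\<integral>\<^sup>+ t\<in>{s..<r}. ennreal (?f t) \<partial>lborel) = ennreal (flow_energy p x (r - s))"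
    by (intro nn_integral_has_integral_lebesgue') auto
  moreover have "(\<integral>\<^sup>+ t\<in>{s..<r}. ennreal (norm (U t s x) powr p) \<partial>lborel) =
      (\<integral>\<^sup>+ t\<in>{s..<r}. ennreal (?f t) \<partial>lborel)"
  proof (rule nn_integral_cong)
    fix t
    show "ennreal (norm (U t s x) powr p) * indicator {s..<r} t = ennreal (?f t) * indicator {s..<r} t"
      using propagator_dwell[OF assms(2), of t] assms(4) by (auto split: split_indicator)
  qed
  ultimately show ?thesis by simp
qed

lemma nn_integral_propagator_Un:
  assumes "0 \<le> s" "B \<in> sets borel" "C \<in> sets borel" "B \<subseteq> {s..}" "C \<subseteq> {s..}" "B \<inter> C = {}"
  shows "(\<integral>\<^sup>+ t\<in>B \<union> C. ennreal (norm (U t s x) powr p) \<partial>lborel) =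
    (\<integral>\<^sup>+ t\<in>B. ennreal (norm (U t s x) powr p) \<partial>lborel) +
    (\<integral>\<^sup>+ t\<in>C. ennreal (norm (U t s x) powr p) \<partial>lborel)"
proof -
  let ?f = "\<lambda>t. ennreal (norm (U t s x) powr p) * indicator {s..} t"
  have *: "(\<integral>\<^sup>+ t\<in>E. ?f t \<partial>lborel) = (\<integral>\<^sup>+ t\<in>E. ennreal (norm (U t s x) powr p) \<partial>lborel)"
    if "E \<subseteq> {s..}" for E
    by (intro nn_integral_cong) (use that in \<open>auto split: split_indicator\<close>)
  have "(\<integral>\<^sup>+ t\<in>B \<union> C. ?f t \<partial>lborel) = (\<integral>\<^sup>+ t\<in>B. ?f t \<partial>lborel) + (\<integral>\<^sup>+ t\<in>C. ?f t \<partial>lborel)"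
    by (rule nn_integral_disjoint_pair) (use assms borel_measurable_propagator in auto)
  then show ?thesis
    using assms by (simp add: *)
qed

lemma nn_integral_split:
  assumes "0 \<le> s" "s \<le> r"
  shows "(\<integral>\<^sup>+ t\<in>{s..}. ennreal (norm (U t s x) powr p) \<partial>lborel) =
    (\<integral>\<^sup>+ t\<in>{s..<r}. ennreal (norm (U t s x) powr p) \<partial>lborel) +
    (\<integral>\<^sup>+ t\<in>{r..}. ennreal (norm (U t s x) powr p) \<partial>lborel)"
proof -
  have "{s..<r} \<subseteq> {s..}" "{s..<r} \<inter> {r..} = {}"
    by auto
  then show ?thesis
    using nn_integral_propagator_Un[of s "{s..<r}" "{r..}" x p] assms by (simp add: ivl_disj_un)
qed

text \<open>A dynamic programming identity: the cost incurred up to time \<open>r\<close>, and the cost of continuing from the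
  state reached at \<open>r\<close>.\<close>

lemma cost_split:
  assumes "0 \<le> s" "s \<le> r"
  shows "cost p s x =
    (\<integral>\<^sup>+ t\<in>{s..<r}. ennreal (norm (U t s x) powr p) \<partial>lborel) +
    (\<Sum>\<^sub>\<infinity>k\<in>{k. 1 \<le> k \<and> s < \<sigma> k \<and> \<sigma> k \<le> r}. ennreal (norm (U_left (\<sigma> k) s x) powr p)) +
    cost p r (U r s x)"
proof -
  let ?g = "\<lambda>k. ennreal (norm (U_left (\<sigma> k) s x) powr p)"
  have "(\<integral>\<^sup>+ t\<in>{r..}. ennreal (norm (U t s x) powr p) \<partial>lborel) =
      (\<integral>\<^sup>+ t\<in>{r..}. ennreal (norm (U t r (U r s x)) powr p) \<partial>lborel)"
  proof (rule nn_integral_cong)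
    fix t
    show "ennreal (norm (U t s x) powr p) * indicator {r..} t =
        ennreal (norm (U t r (U r s x)) powr p) * indicator {r..} t"
      using propagator_cocycle_apply[OF assms(2), of t x] by (cases "r \<le> t") (simp_all only:, simp)
  qed
  moreover have "infsum ?g {k. 1 \<le> k \<and> r < \<sigma> k} =
      (\<Sum>\<^sub>\<infinity>k\<in>{k. 1 \<le> k \<and> r < \<sigma> k}. ennreal (norm (U_left (\<sigma> k) r (U r s x)) powr p))"
  proof (intro infsum_cong)
    fix k assume "k \<in> {k. 1 \<le> k \<and> r < \<sigma> k}"
    then obtain m where "k = Suc m" "r < \<sigma> (Suc m)"
      by (cases k) auto
    then show "?g k = ennreal (norm (U_left (\<sigma> k) r (U r s x)) powr p)"
      using propagator_left_cocycle[OF assms, of m x] by simp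
  qed
  moreover have "infsum ?g {k. 1 \<le> k \<and> s < \<sigma> k} =
      infsum ?g {k. 1 \<le> k \<and> s < \<sigma> k \<and> \<sigma> k \<le> r} + infsum ?g {k. 1 \<le> k \<and> r < \<sigma> k}"
  proof -
    have "{k. 1 \<le> k \<and> s < \<sigma> k} = {k. 1 \<le> k \<and> s < \<sigma> k \<and> \<sigma> k \<le> r} \<union> {k. 1 \<le> k \<and> r < \<sigma> k}"
      using assms(2) by auto
    then show ?thesis
      by (simp only:) (intro infsum_Un_disjoint nonneg_summable_on_complete, auto)
  qed
  ultimately show ?thesis
    unfolding datko_cost_def nn_integral_split[OF assms] by (simp add: ac_simps)
qed

lemma cost_within_dwell:
  assumes "1 \<le> p" "\<sigma> l \<le> s" "s \<le> r" "r < \<sigma> (Suc l)"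
  shows "cost p s x =
    ennreal (flow_energy p x (r - s)) + cost p r (S (r - s) x)"
proof -
  have "{k. 1 \<le> k \<and> s < \<sigma> k \<and> \<sigma> k \<le> r} = {}"
    using dwell_less_iff[OF assms(2) order_le_less_trans[OF assms(3,4)]]
      dwell_less_iff[OF order_trans[OF assms(2,3)] assms(4)]
    by (auto simp: not_less[symmetric])
  then have "(\<Sum>\<^sub>\<infinity>k\<in>{k. 1 \<le> k \<and> s < \<sigma> k \<and> \<sigma> k \<le> r}. ennreal (norm (U_left (\<sigma> k) s x) powr p)) = 0"
    by (simp only: infsum_empty)
  moreover have "0 \<le> s"
    using assms(2) sigma_nonneg[of l] by linarith
  ultimately show ?thesis
    using cost_split[of s r p x] nn_integral_within_dwell[of p l s r x] propagator_dwell[of l s r] assms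
    by simp
qed

lemma cost_until_jump:
  assumes "1 \<le> p" "\<sigma> l \<le> s" "s < \<sigma> (Suc l)"
  defines "b \<equiv> \<sigma> (Suc l)"
  shows "cost p s x =
    ennreal (flow_energy p x (b - s)) +
    ennreal (norm (S (b - s) x) powr p) + cost p b (J (S (b - s) x))"
proof -
  have "s \<le> b"
    using assms(3) unfolding b_def by linarith
  have "{k. 1 \<le> k \<and> s < \<sigma> k \<and> \<sigma> k \<le> b} = {Suc l}"
    unfolding b_def dwell_less_iff[OF assms(2,3)] sigma_le_iff by auto
  then have "(\<Sum>\<^sub>\<infinity>k\<in>{k. 1 \<le> k \<and> s < \<sigma> k \<and> \<sigma> k \<le> b}. ennreal (norm (U_left (\<sigma> k) s x) powr p)) =
      ennreal (norm (S (b - s) x) powr p)"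
    using propagator_left_dwell[OF assms(2,3), of x] by (simp add: b_def)
  moreover have "U b s x = J (S (b - s) x)"
    unfolding b_def by (rule propagator_jump[OF assms(2,3)])
  moreover have "0 \<le> s"
    using assms(2) sigma_nonneg[of l] by linarith
  ultimately show ?thesis
    using cost_split[OF _ \<open>s \<le> b\<close>, of p x] nn_integral_within_dwell[OF assms(1,2) \<open>s \<le> b\<close>, of x]
    by (simp add: b_def)
qed

lemma infsum_later_impulses:
  fixes g :: "nat \<Rightarrow> ennreal"
  assumes "\<sigma> l \<le> s" "s < \<sigma> (Suc l)"
  shows "infsum g {k. 1 \<le> k \<and> s < \<sigma> k} = (SUP F\<in>{F. finite F \<and> F \<subseteq> {l<..}}. sum g F)"
proof -
  have "{k. 1 \<le> k \<and> s < \<sigma> k} = {l<..}"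
    unfolding dwell_less_iff[OF assms] by auto
  then have "infsum g {k. 1 \<le> k \<and> s < \<sigma> k} = infsum g {l<..}"
    by (simp only:)
  also have "\<dots> = (SUP F\<in>{F. finite F \<and> F \<subseteq> {l<..}}. sum g F)"
    by (rule nonneg_infsum_complete) simp
  finally show ?thesis .
qed

text \<open>Both parts of the cost are suprema of increasing truncations at the impulse times, so a
  bound on the truncated costs is inherited by the cost. It reduces estimates and convexity to
  finite sums.\<close>

lemma cost_le:
  assumes "\<sigma> l \<le> s" "s < \<sigma> (Suc l)"
    and bound: "\<And>n. l < n \<Longrightarrow>
      (\<integral>\<^sup>+ t\<in>{s..<\<sigma> n}. ennreal (norm (U t s x) powr p) \<partial>lborel) +
      (\<Sum>k\<in>{l<..n}. ennreal (norm (U_left (\<sigma> k) s x) powr p)) \<le> B"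
  shows "cost p s x \<le> B"
proof -
  have s: "0 \<le> s"
    using assms(1) sigma_nonneg[of l] by linarith
  let ?h = "\<lambda>t. ennreal (norm (U t s x) powr p)"
  let ?g = "\<lambda>k. ennreal (norm (U_left (\<sigma> k) s x) powr p)"
  let ?I = "\<lambda>n. \<integral>\<^sup>+ t\<in>{s..<\<sigma> n}. ?h t \<partial>lborel"
  let ?G = "\<lambda>n. \<Sum>k\<in>{l<..n}. ?g k"
  have ind_mono: "incseq (\<lambda>n t. ?h t * indicator {s..<\<sigma> n} t)"
  proof (intro incseq_SucI le_funI mult_left_mono)
    show "indicator {s..<\<sigma> n} t \<le> (indicator {s..<\<sigma> (Suc n)} t :: ennreal)" for n t
      using sigma_less_iff[of n "Suc n"] by (auto split: split_indicator simp del: sigma_less_iff)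
  qed simp
  have I_mono: "incseq ?I"
    using ind_mono by (auto simp: incseq_def le_fun_def intro!: nn_integral_mono)
  have G_mono: "incseq ?G"
    unfolding incseq_def by (intro allI impI sum_mono2) auto
  have meas: "(\<lambda>t. ?h t * indicator {s..<\<sigma> n} t) \<in> borel_measurable lborel" for n
    by (rule borel_measurable_propagator_on[OF s]) auto
  have "(\<integral>\<^sup>+ t\<in>{s..}. ?h t \<partial>lborel) \<le> (\<integral>\<^sup>+ t. (SUP n. ?h t * indicator {s..<\<sigma> n} t) \<partial>lborel)"
  proof (rule nn_integral_mono)
    fix t
    obtain n where "t < \<sigma> n" using sigma_unbounded by blast
    then show "?h t * indicator {s..} t \<le> (SUP n. ?h t * indicator {s..<\<sigma> n} t)"
      by (intro SUP_upper2[of n]) (auto split: split_indicator)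
  qed
  also have "\<dots> = (SUP n. ?I n)"
    by (rule nn_integral_monotone_convergence_SUP[OF ind_mono meas])
  finally have int_le: "(\<integral>\<^sup>+ t\<in>{s..}. ?h t \<partial>lborel) \<le> (SUP n. ?I n)" .
  have "infsum ?g {k. 1 \<le> k \<and> s < \<sigma> k} = (SUP F\<in>{F. finite F \<and> F \<subseteq> {l<..}}. sum ?g F)"
    by (rule infsum_later_impulses[OF assms(1,2)])
  also have "\<dots> \<le> (SUP n. ?G n)"
  proof (rule SUP_least)
    fix F assume F: "F \<in> {F. finite F \<and> F \<subseteq> {l<..}}"
    then obtain n where "F \<subseteq> {..n}"
      using finite_nat_set_iff_bounded_le[of F] by auto
    with F show "sum ?g F \<le> (SUP n. ?G n)"
      by (intro SUP_upper2[of n] sum_mono2) auto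
  qed
  finally have "cost p s x \<le> (SUP n. ?I n) + (SUP n. ?G n)"
    unfolding datko_cost_def using int_le by (intro add_mono) auto
  also have "\<dots> = (SUP n. ?I n + ?G n)"
    by (rule ennreal_SUP_add[OF I_mono G_mono, symmetric])
  also have "\<dots> \<le> B"
  proof (rule SUP_least)
    fix n
    \<comment> \<open>Truncations that end before \<open>s\<close> are not covered by the hypothesis; enlarge them.\<close>
    let ?m = "max n (Suc l)"
    have "?I n + ?G n \<le> ?I ?m + ?G ?m"
      by (intro add_mono incseqD[OF I_mono] incseqD[OF G_mono]) auto
    also have "\<dots> \<le> B" by (rule bound) simp
    finally show "?I n + ?G n \<le> B" .
  qed
  finally show ?thesis .
qed

lemma cost_ge:
  assumes "\<sigma> l \<le> s" "s < \<sigma> (Suc l)" "B \<subseteq> {s..}"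
  shows "(\<integral>\<^sup>+ t\<in>B. ennreal (norm (U t s x) powr p) \<partial>lborel) +
      (\<Sum>k\<in>{l<..n}. ennreal (norm (U_left (\<sigma> k) s x) powr p)) \<le> cost p s x"
  unfolding datko_cost_def
proof (rule add_mono)
  show "(\<integral>\<^sup>+ t\<in>B. ennreal (norm (U t s x) powr p) \<partial>lborel) \<le>
      (\<integral>\<^sup>+ t\<in>{s..}. ennreal (norm (U t s x) powr p) \<partial>lborel)"
  proof (rule nn_integral_mono)
    fix t
    show "ennreal (norm (U t s x) powr p) * indicator B t \<le> ennreal (norm (U t s x) powr p) * indicator {s..} t"
      using assms(3) by (cases "t \<in> B") (auto simp: subset_iff)
  qed
  let ?g = "\<lambda>k. ennreal (norm (U_left (\<sigma> k) s x) powr p)"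
  have "infsum ?g {k. 1 \<le> k \<and> s < \<sigma> k} = (SUP F\<in>{F. finite F \<and> F \<subseteq> {l<..}}. sum ?g F)"
    by (rule infsum_later_impulses[OF assms(1,2)])
  moreover have "sum ?g {l<..n} \<le> (SUP F\<in>{F. finite F \<and> F \<subseteq> {l<..}}. sum ?g F)"
    by (rule SUP_upper) auto
  ultimately show "sum ?g {l<..n} \<le> infsum ?g {k. 1 \<le> k \<and> s < \<sigma> k}"
    by (simp only:)
qed

end

section \<open>Exponential decay bounds the cost\<close>

context impulsive_system
begin

text \<open>Immediately before the impulse \<open>Suc m\<close> only the impulses \<open>Suc l, \<dots>, m\<close> have occurred, whence the exponent
  \<open>m - l\<close>.\<close>

lemma norm_propagator_left_le:
  assumes "\<sigma> l \<le> s" "s < \<sigma> (Suc l)" "l \<le> m" "0 \<le> M" "0 < \<alpha>" "0 \<le> \<rho>"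
    and decay: "\<And>t. s \<le> t \<Longrightarrow> norm (U t s) \<le> M * \<rho> ^ impulse_count \<sigma> t s * exp (- \<alpha> * (t - s))"
  shows "norm (U_left (\<sigma> (Suc m)) s x) \<le> M * \<rho> ^ (m - l) * norm x"
proof (rule tendsto_upperbound)
  have s: "0 \<le> s"
    using assms(1) sigma_nonneg[of l] by linarith
  have sm: "s < \<sigma> (Suc m)"
    using dwell_less_iff[OF assms(1,2)] assms(3) by simp
  show "((\<lambda>t. norm (U t s x)) \<longlongrightarrow> norm (U_left (\<sigma> (Suc m)) s x)) (at_left (\<sigma> (Suc m)))"
    by (intro tendsto_norm propagator_tendsto_propagator_left s sm)
  have "max s (\<sigma> m) < \<sigma> (Suc m)" using sm by simp
  from eventually_at_left_real[OF this]
  show "\<forall>\<^sub>F t in at_left (\<sigma> (Suc m)). norm (U t s x) \<le> M * \<rho> ^ (m - l) * norm x"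
  proof eventually_elim
    case (elim t)
    have "impulse_count \<sigma> t s = m - l"
      by (rule impulse_count_eq) (use assms elim in auto)
    then have "norm (U t s) \<le> M * \<rho> ^ (m - l) * exp (- \<alpha> * (t - s))"
      using decay[of t] elim by auto
    also have "\<dots> \<le> M * \<rho> ^ (m - l) * 1"
      using assms elim by (intro mult_left_mono) auto
    finally show ?case
      by (intro order_trans[OF norm_blinfun] mult_right_mono) auto
  qed
qed auto

lemma cost_le_of_decay:
  assumes p: "1 \<le> p" and "0 < M" "0 < \<alpha>" "0 < \<rho>" "\<rho> < 1"
    and decay: "\<And>s t. 0 \<le> s \<Longrightarrow> s \<le> t \<Longrightarrow>
      norm (U t s) \<le> M * \<rho> ^ impulse_count \<sigma> t s * exp (- \<alpha> * (t - s))"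
    and s: "0 \<le> s"
  shows "cost p s x \<le> ennreal (M powr p * (1 / (\<alpha> * p) + 1 / (1 - \<rho> powr p)) * norm x powr p)"
proof -
  define C where "C = M powr p * norm x powr p"
  have C: "0 \<le> C" by (simp add: C_def)
  obtain l where l: "\<sigma> l \<le> s" "s < \<sigma> (Suc l)"
    using dwell_index[OF s] .
  have rp: "0 < \<rho> powr p" "\<rho> powr p < 1"
    using assms powr_less_mono2[of p \<rho> 1] by auto
  have "norm (U t s x) powr p \<le> C * exp (- (\<alpha> * p) * (t - s))" if "s \<le> t" for t
  proof -
    have "\<rho> ^ impulse_count \<sigma> t s \<le> 1"
      using assms by (intro power_le_one) auto
    then have "M * \<rho> ^ impulse_count \<sigma> t s * exp (- \<alpha> * (t - s)) \<le> M * 1 * exp (- \<alpha> * (t - s))"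
      using \<open>0 < M\<close> by (intro mult_right_mono mult_left_mono) auto
    then have "norm (U t s) \<le> M * exp (- \<alpha> * (t - s))"
      using decay[OF s that] by simp
    then have "norm (U t s x) \<le> M * exp (- \<alpha> * (t - s)) * norm x"
      by (intro order_trans[OF norm_blinfun] mult_right_mono) auto
    then have "norm (U t s x) powr p \<le> (M * exp (- \<alpha> * (t - s)) * norm x) powr p"
      using p by (intro powr_mono2) auto
    also have "\<dots> = C * exp (- (\<alpha> * p) * (t - s))"
      using \<open>0 < M\<close> by (simp add: powr_mult C_def exp_powr_real algebra_simps)
    finally show ?thesis .
  qed
  then have "(\<integral>\<^sup>+ t\<in>{s..}. ennreal (norm (U t s x) powr p) \<partial>lborel) \<le>
      (\<integral>\<^sup>+ t\<in>{s..}. ennreal (C * exp (- (\<alpha> * p) * (t - s))) \<partial>lborel)"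
    by (intro nn_integral_mono) (auto split: split_indicator intro!: ennreal_leI)
  also have "\<dots> = ennreal (0 - (- C / (\<alpha> * p) * exp (- (\<alpha> * p) * (s - s))))"
  proof (rule nn_integral_FTC_atLeast[where F = "\<lambda>t. - C / (\<alpha> * p) * exp (- (\<alpha> * p) * (t - s))"])
    show "((\<lambda>t. - C / (\<alpha> * p) * exp (- (\<alpha> * p) * (t - s))) has_real_derivative
        C * exp (- (\<alpha> * p) * (t - s))) (at t)" for t
      using assms by (auto intro!: derivative_eq_intros)
    have "filterlim (\<lambda>t. \<alpha> * p * (t - s)) at_top at_top"
      using assms
      by (intro filterlim_tendsto_pos_mult_at_top[OF tendsto_const]
          filterlim_tendsto_add_at_top[OF tendsto_const[of "- s"] filterlim_ident, simplified]) auto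
    then have "((\<lambda>t. exp (- (\<alpha> * p * (t - s)))) \<longlongrightarrow> 0) at_top"
      by (intro filterlim_compose[OF exp_at_bot] filterlim_compose[OF filterlim_uminus_at_bot_at_top])
    then show "((\<lambda>t. - C / (\<alpha> * p) * exp (- (\<alpha> * p) * (t - s))) \<longlongrightarrow> 0) at_top"
      by (intro tendsto_mult_right_zero) simp
  qed (use C in auto)
  finally have int: "(\<integral>\<^sup>+ t\<in>{s..}. ennreal (norm (U t s x) powr p) \<partial>lborel) \<le> ennreal (C * (1 / (\<alpha> * p)))"
    by simp
  have jump: "norm (U_left (\<sigma> k) s x) powr p \<le> C * (\<rho> powr p) ^ (k - Suc l)" if "l < k" for k
  proof -
    obtain m where m: "k = Suc m" "l \<le> m"
      using less_imp_Suc_add[OF \<open>l < k\<close>] by force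
    have "norm (U_left (\<sigma> k) s x) \<le> M * \<rho> ^ (m - l) * norm x"
      unfolding m(1) by (rule norm_propagator_left_le[OF l m(2) _ \<open>0 < \<alpha>\<close>]) (use assms in auto)
    then have "norm (U_left (\<sigma> k) s x) powr p \<le> (M * \<rho> ^ (m - l) * norm x) powr p"
      using p by (intro powr_mono2) auto
    also have "\<dots> = C * (\<rho> powr p) ^ (k - Suc l)"
      using assms by (simp add: powr_mult C_def m powr_power powr_powr mult.commute flip: powr_realpow)
    finally show ?thesis .
  qed
  show ?thesis
  proof (rule cost_le[OF l])
    fix n
    have "(\<Sum>k\<in>{l<..n}. norm (U_left (\<sigma> k) s x) powr p) \<le> (\<Sum>k\<in>{l<..n}. C * (\<rho> powr p) ^ (k - Suc l))"
      by (intro sum_mono jump) auto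
    also have "\<dots> = C * (\<Sum>j\<in>(\<lambda>k. k - Suc l) ` {l<..n}. (\<rho> powr p) ^ j)"
      by (subst sum.reindex) (auto simp: sum_distrib_left inj_on_def)
    also have "\<dots> \<le> C * (1 / (1 - \<rho> powr p))"
      using C rp by (intro mult_left_mono less_imp_le[OF geometric_sum_less]) auto
    finally have sum: "(\<Sum>k\<in>{l<..n}. ennreal (norm (U_left (\<sigma> k) s x) powr p)) \<le>
        ennreal (C * (1 / (1 - \<rho> powr p)))"
      by (simp add: ennreal_leI)
    have "(\<integral>\<^sup>+ t\<in>{s..<\<sigma> n}. ennreal (norm (U t s x) powr p) \<partial>lborel) \<le>
        (\<integral>\<^sup>+ t\<in>{s..}. ennreal (norm (U t s x) powr p) \<partial>lborel)"
      by (intro nn_integral_mono) (auto split: split_indicator)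
    also note int
    finally have "(\<integral>\<^sup>+ t\<in>{s..<\<sigma> n}. ennreal (norm (U t s x) powr p) \<partial>lborel) +
        (\<Sum>k\<in>{l<..n}. ennreal (norm (U_left (\<sigma> k) s x) powr p)) \<le>
        ennreal (C * (1 / (\<alpha> * p))) + ennreal (C * (1 / (1 - \<rho> powr p)))"
      using sum by (intro add_mono)
    also have "\<dots> = ennreal (C * (1 / (\<alpha> * p)) + C * (1 / (1 - \<rho> powr p)))"
      using C rp assms by (intro ennreal_plus[symmetric]) auto
    also have "C * (1 / (\<alpha> * p)) + C * (1 / (1 - \<rho> powr p)) =
        M powr p * (1 / (\<alpha> * p) + 1 / (1 - \<rho> powr p)) * norm x powr p"
      by (simp add: C_def algebra_simps)
    finally show "(\<integral>\<^sup>+ t\<in>{s..<\<sigma> n}. ennreal (norm (U t s x) powr p) \<partial>lborel) +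
        (\<Sum>k\<in>{l<..n}. ennreal (norm (U_left (\<sigma> k) s x) powr p)) \<le>
        ennreal (M powr p * (1 / (\<alpha> * p) + 1 / (1 - \<rho> powr p)) * norm x powr p)" .
  qed
qed

end

section \<open>The cost functional is a Lyapunov functional\<close>

context impulsive_system
begin

lemma propagator_left_linear:
  assumes "0 \<le> s" "s < \<sigma> (Suc m)"
  shows "U_left (\<sigma> (Suc m)) s (u *\<^sub>R x + v *\<^sub>R y) =
    u *\<^sub>R U_left (\<sigma> (Suc m)) s x + v *\<^sub>R U_left (\<sigma> (Suc m)) s y"
  using propagator_left_eq[of s "max s (\<sigma> m)" m] assms
  by (simp add: blinfun.add_right blinfun.scaleR_right)

text \<open>The cost is assembled from the convex functions \<open>x \<mapsto> \<parallel>B x\<parallel>\<^sup>p\<close> with \<open>B\<close> linear.\<close>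

lemma cost_convex:
  assumes p: "1 \<le> p" and s: "0 \<le> s" and uv: "0 \<le> u" "0 \<le> v" "u + v = 1"
  shows "cost p s (u *\<^sub>R x + v *\<^sub>R y) \<le> ennreal u * cost p s x + ennreal v * cost p s y"
proof -
  obtain l where l: "\<sigma> l \<le> s" "s < \<sigma> (Suc l)"
    using dwell_index[OF s] .
  have pointwise: "ennreal (norm (u *\<^sub>R a + v *\<^sub>R b) powr p) \<le>
      ennreal u * ennreal (norm a powr p) + ennreal v * ennreal (norm b powr p)" for a b :: 'a
  proof -
    have "norm (u *\<^sub>R a + v *\<^sub>R b) \<le> u * norm a + v * norm b"
      using norm_triangle_ineq[of "u *\<^sub>R a" "v *\<^sub>R b"] uv by simp
    then have "norm (u *\<^sub>R a + v *\<^sub>R b) powr p \<le> (u * norm a + v * norm b) powr p"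
      using p by (intro powr_mono2) auto
    also have "\<dots> \<le> u * norm a powr p + v * norm b powr p"
      by (rule convex_combination_powr_le[OF p _ _ uv]) auto
    finally show ?thesis
      using uv by (simp add: ennreal_leI flip: ennreal_mult ennreal_plus)
  qed
  let ?z = "u *\<^sub>R x + v *\<^sub>R y"
  let ?h = "\<lambda>x t. ennreal (norm (U t s x) powr p)"
  let ?g = "\<lambda>x k. ennreal (norm (U_left (\<sigma> k) s x) powr p)"
  show ?thesis
  proof (rule cost_le[OF l])
    fix n
    let ?I = "\<lambda>x. \<integral>\<^sup>+ t\<in>{s..<\<sigma> n}. ?h x t \<partial>lborel"
    have meas: "(\<lambda>t. ?h x t * indicator {s..<\<sigma> n} t) \<in> borel_measurable lborel" for x
      by (rule borel_measurable_propagator_on[OF s]) auto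
    have "?I ?z \<le> (\<integral>\<^sup>+ t. ennreal u * (?h x t * indicator {s..<\<sigma> n} t) +
        ennreal v * (?h y t * indicator {s..<\<sigma> n} t) \<partial>lborel)"
      using pointwise
      by (intro nn_integral_mono) (auto simp: blinfun.add_right blinfun.scaleR_right split: split_indicator)
    also have "\<dots> = ennreal u * ?I x + ennreal v * ?I y"
      using meas by (subst nn_integral_add) (auto simp: nn_integral_cmult)
    finally have int: "?I ?z \<le> ennreal u * ?I x + ennreal v * ?I y" .
    have "?g ?z k \<le> ennreal u * ?g x k + ennreal v * ?g y k" if "k \<in> {l<..n}" for k
    proof -
      obtain m where m: "k = Suc m" "l \<le> m"
        using less_imp_Suc_add[of l k] \<open>k \<in> {l<..n}\<close> by force
      then have "s < \<sigma> (Suc m)"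
        using dwell_less_iff[OF l] by simp
      then show ?thesis
        unfolding m(1) using pointwise by (simp only: propagator_left_linear[OF s])
    qed
    then have "sum (?g ?z) {l<..n} \<le> (\<Sum>k\<in>{l<..n}. ennreal u * ?g x k + ennreal v * ?g y k)"
      by (rule sum_mono)
    also have "\<dots> = ennreal u * sum (?g x) {l<..n} + ennreal v * sum (?g y) {l<..n}"
      by (simp only: sum.distrib sum_distrib_left)
    finally have "?I ?z + sum (?g ?z) {l<..n} \<le>
        (ennreal u * ?I x + ennreal v * ?I y) +
        (ennreal u * sum (?g x) {l<..n} + ennreal v * sum (?g y) {l<..n})"
      using int by (intro add_mono)
    also have "\<dots> = ennreal u * (?I x + sum (?g x) {l<..n}) + ennreal v * (?I y + sum (?g y) {l<..n})"
      by (simp only: distrib_left ac_simps)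
    also have "\<dots> \<le> ennreal u * cost p s x + ennreal v * cost p s y"
      by (intro add_mono mult_left_mono cost_ge[OF l]) auto
    finally show "?I ?z + sum (?g ?z) {l<..n} \<le> ennreal u * cost p s x + ennreal v * cost p s y" .
  qed
qed

text \<open>On a dwell interval \<open>[\<sigma> l, \<sigma> (Suc l))\<close> the cost depends on \<open>t\<close> only through the remaining time
  \<open>\<tau> = \<sigma> (Suc l) - t\<close>, by the formula \<open>W\<close> in the proof, which is continuous up to \<open>\<tau> = 0\<close>. This gives
  continuity from the right, the left limits at impulse times, and equality in the jump condition.\<close>

lemma lyapunov_functional_cost:
  assumes p: "1 \<le> p" and C: "0 \<le> C"
    and bound: "\<And>s x. 0 \<le> s \<Longrightarrow> cost p s x \<le> ennreal (C * norm x powr p)"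
  shows "lyapunov_functional S J \<sigma> p C (\<lambda>t x. enn2real (cost p t x))"
proof -
  define V where "V = (\<lambda>t x. enn2real (cost p t x))"
  have V: "cost p t x = ennreal (V t x)" if "0 \<le> t" for t x
    using bound[OF that, of x] unfolding V_def
    by (metis ennreal_enn2real ennreal_less_top order_le_less_trans)
  have V_nonneg: "0 \<le> V t x" for t x
    by (simp add: V_def)
  have V_le: "V t x \<le> C * norm x powr p" if "0 \<le> t" for t x
    using bound[OF that, of x] C unfolding V[OF that] by (simp add: ennreal_le_iff)
  have "convex_on UNIV (V t)" if "0 \<le> t" for t
  proof (rule convex_onI)
    fix w :: real and x y :: 'a
    assume w: "0 < w" "w < 1"
    then have "ennreal (V t ((1 - w) *\<^sub>R x + w *\<^sub>R y)) \<le>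
        ennreal (1 - w) * ennreal (V t x) + ennreal w * ennreal (V t y)"
      using cost_convex[OF p that, of "1 - w" w x y] by (simp flip: V[OF that])
    also have "\<dots> = ennreal ((1 - w) * V t x + w * V t y)"
      using w V_nonneg by (simp add: ennreal_mult ennreal_plus)
    finally show "V t ((1 - w) *\<^sub>R x + w *\<^sub>R y) \<le> (1 - w) * V t x + w * V t y"
      by (rule ennreal_le_iff[THEN iffD1, rotated]) (use w V_nonneg in auto)
  qed simp
  note V_convex = this
  have V_lipschitz: "lipschitz_on_bounded V"
    unfolding lipschitz_on_bounded_def
  proof (intro allI impI)
    fix r :: real assume r: "0 < r"
    \<comment> \<open>The constant below is enlarged by \<open>1\<close> to be positive even if \<open>C = 0\<close>.\<close>
    let ?L = "C * (2 * r) powr p / r"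
    have "?L-lipschitz_on (ball 0 r) (V t)" if "0 \<le> t" for t
    proof (rule convex_bounded_imp_lipschitz_on[OF V_convex[OF that] r])
      fix x :: 'a assume "norm x < 2 * r"
      then have "C * norm x powr p \<le> C * (2 * r) powr p"
        using C p by (intro mult_left_mono powr_mono2) auto
      then show "0 \<le> V t x \<and> V t x \<le> C * (2 * r) powr p"
        using V_le[OF that, of x] V_nonneg by auto
    qed
    then have "\<forall>t\<ge>0. (?L + 1)-lipschitz_on (ball 0 r) (V t)"
      by (intro allI impI) (rule lipschitz_on_mono[of ?L "ball 0 r"], auto)
    moreover have "0 < ?L + 1"
      using C r by (simp add: add_nonneg_pos)
    ultimately show "\<exists>L>0. \<forall>t\<ge>0. L-lipschitz_on (ball 0 r) (V t)"
      by blast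
  qed
  have V_flow: "V t x = flow_energy p x h + V (t + h) (S h x)"
    if "\<sigma> l \<le> t" "0 \<le> h" "t + h < \<sigma> (Suc l)" for l t h x
  proof -
    have t: "0 \<le> t" using that sigma_nonneg[of l] by linarith
    have "ennreal (V t x) = ennreal (flow_energy p x h) + ennreal (V (t + h) (S h x))"
      using cost_within_dwell[OF p that(1), of "t + h" x] that t by (simp flip: V)
    also have "\<dots> = ennreal (flow_energy p x h + V (t + h) (S h x))"
      by (simp add: flow_energy_nonneg V_nonneg)
    finally show ?thesis
      by (rule ennreal_inj[THEN iffD1, rotated 2]) (simp_all add: flow_energy_nonneg V_nonneg)
  qed
  define W where "W = (\<lambda>l x \<tau>. flow_energy p x \<tau> + norm (S \<tau> x) powr p + V (\<sigma> (Suc l)) (J (S \<tau> x)))"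
  have V_jump: "V t x = W l x (\<sigma> (Suc l) - t)" if "\<sigma> l \<le> t" "t < \<sigma> (Suc l)" for l t x
  proof -
    have t: "0 \<le> t" using that sigma_nonneg[of l] by linarith
    let ?\<tau> = "\<sigma> (Suc l) - t"
    have "ennreal (V t x) = ennreal (flow_energy p x ?\<tau>) + ennreal (norm (S ?\<tau> x) powr p) +
        ennreal (V (\<sigma> (Suc l)) (J (S ?\<tau> x)))"
      using cost_until_jump[OF p that, of x] t by (simp flip: V)
    also have "\<dots> = ennreal (W l x ?\<tau>)"
      by (simp add: W_def flow_energy_nonneg V_nonneg)
    finally show ?thesis
      by (rule ennreal_inj[THEN iffD1, rotated 2]) (simp_all add: W_def flow_energy_nonneg V_nonneg)
  qed
  have W_continuous: "continuous_on {0..\<sigma> (Suc l) - \<sigma> l} (W l x)" for l x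
    unfolding W_def
  proof (intro continuous_on_add continuous_on_flow_energy[OF p] continuous_on_norm_S_powr[OF p])
    have "continuous_on {0..\<sigma> (Suc l) - \<sigma> l} (\<lambda>\<tau>. J (S \<tau> x))"
      by (rule bounded_linear.continuous_on[OF blinfun.bounded_linear_right continuous_on_S])
    then have "((\<lambda>\<tau>. J (S \<tau> x)) \<longlongrightarrow> J (S u x)) (at u within {0..\<sigma> (Suc l) - \<sigma> l})"
      if "u \<in> {0..\<sigma> (Suc l) - \<sigma> l}" for u
      using that unfolding continuous_on_def by (rule bspec)
    then show "continuous_on {0..\<sigma> (Suc l) - \<sigma> l} (\<lambda>\<tau>. V (\<sigma> (Suc l)) (J (S \<tau> x)))"
      unfolding continuous_on_def
      by (intro ballI, rule lipschitz_on_bounded_tendsto[OF V_lipschitz, where g = "\<lambda>_. \<sigma> (Suc l)"]) simp_all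
  qed
  have V_left_limit: "((\<lambda>t. V t x) \<longlongrightarrow> norm x powr p + V (\<sigma> (Suc l)) (J x)) (at_left (\<sigma> (Suc l)))"
    for l x
  proof -
    have "continuous_on {\<sigma> l..\<sigma> (Suc l)} (\<lambda>t. W l x (\<sigma> (Suc l) - t))"
    proof (rule continuous_on_compose2[OF W_continuous[of l x]])
      show "continuous_on {\<sigma> l..\<sigma> (Suc l)} (\<lambda>t. \<sigma> (Suc l) - t)"
        by (intro continuous_intros)
    qed auto
    then have "((\<lambda>t. W l x (\<sigma> (Suc l) - t)) \<longlongrightarrow> W l x (\<sigma> (Suc l) - \<sigma> (Suc l)))
        (at (\<sigma> (Suc l)) within {\<sigma> l..\<sigma> (Suc l)})"
      unfolding continuous_on_def by (rule bspec) simp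
    moreover have "at (\<sigma> (Suc l)) within {\<sigma> l..\<sigma> (Suc l)} = at_left (\<sigma> (Suc l))"
      by (rule at_within_Icc_at_left) simp
    ultimately have "((\<lambda>t. W l x (\<sigma> (Suc l) - t)) \<longlongrightarrow> norm x powr p + V (\<sigma> (Suc l)) (J x))
        (at_left (\<sigma> (Suc l)))"
      by (simp add: W_def)
    moreover have "\<forall>\<^sub>F t in at_left (\<sigma> (Suc l)). W l x (\<sigma> (Suc l) - t) = V t x"
      using eventually_at_left_real[of "\<sigma> l" "\<sigma> (Suc l)"]
      by (rule eventually_mono) (use V_jump[symmetric] in auto)
    ultimately show ?thesis
      by (rule Lim_transform_eventually)
  qed
  have "piecewise_right_continuous \<sigma> V"
    unfolding piecewise_right_continuous_def
  proof (intro allI conjI ballI)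
    fix x k
    have "continuous_on {\<sigma> k..<\<sigma> (Suc k)} (\<lambda>t. W k x (\<sigma> (Suc k) - t))"
    proof (rule continuous_on_compose2[OF W_continuous[of k x]])
      show "continuous_on {\<sigma> k..<\<sigma> (Suc k)} (\<lambda>t. \<sigma> (Suc k) - t)"
        by (intro continuous_intros)
    qed auto
    then show "continuous_on {\<sigma> k..<\<sigma> (Suc k)} (\<lambda>t. V t x)"
      by (rule continuous_on_eq) (use V_jump[symmetric] in auto)
  next
    fix x t assume "t \<in> impulse_times \<sigma>"
    then obtain m where "t = \<sigma> (Suc m)"
      by (auto simp: impulse_times_def Suc_le_eq gr0_conv_Suc)
    then show "\<exists>l. ((\<lambda>\<tau>. V \<tau> x) \<longlongrightarrow> l) (at_left t)"
      using V_left_limit by blast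
  qed
  moreover have "lower_Dini S V t x \<le> ereal (- (norm x powr p))" if "0 \<le> t" for t x
  proof -
    obtain l where l: "\<sigma> l \<le> t" "t < \<sigma> (Suc l)"
      using dwell_index[OF \<open>0 \<le> t\<close>] .
    have "((\<lambda>h. flow_energy p x h / h) \<longlongrightarrow> norm x powr p) (at_right 0)"
      using flow_energy_right_derivative[OF p, of 0 l x] by simp
    then have lim: "((\<lambda>h. ereal (- (flow_energy p x h / h))) \<longlongrightarrow> ereal (- (norm x powr p))) (at_right 0)"
      by (intro tendsto_ereal tendsto_minus)
    have "\<forall>\<^sub>F h in at_right 0. ereal (- (flow_energy p x h / h)) = ereal ((V (t + h) (S h x) - V t x) / h)"
    proof (rule eventually_mono[OF eventually_at_right_real])
      show "0 < \<sigma> (Suc l) - t" using l(2) by simp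
      fix h assume "h \<in> {0<..<\<sigma> (Suc l) - t}"
      then show "ereal (- (flow_energy p x h / h)) = ereal ((V (t + h) (S h x) - V t x) / h)"
        using V_flow[OF l(1), of h x] by (simp add: field_simps)
    qed
    with lim have "((\<lambda>h. ereal ((V (t + h) (S h x) - V t x) / h)) \<longlongrightarrow> ereal (- (norm x powr p))) (at_right 0)"
      by (rule Lim_transform_eventually)
    then have "lower_Dini S V t x = ereal (- (norm x powr p))"
      unfolding lower_Dini_def by (intro lim_imp_Liminf) auto
    then show ?thesis by (simp only: order_refl)
  qed
  moreover have "V t (J x) - Lim (at_left t) (\<lambda>\<tau>. V \<tau> x) \<le> - (norm x powr p)" if t: "t \<in> impulse_times \<sigma>" for t x
  proof -
    obtain m where m: "t = \<sigma> (Suc m)"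
      using t by (auto simp: impulse_times_def Suc_le_eq gr0_conv_Suc)
    show ?thesis
      unfolding m using tendsto_Lim[OF _ V_left_limit[of x m]] by simp
  qed
  ultimately show ?thesis
    using V_nonneg V_lipschitz V_le unfolding lyapunov_functional_def V_def[symmetric] by blast
qed

end

section \<open>A Lyapunov functional bounds the cost\<close>

context impulsive_system
begin

text \<open>A lower Dini derivative bounds the difference quotients for arbitrarily small steps only, not for all of them.\<close>

lemma lower_Dini_le_imp_frequently:
  assumes "lower_Dini S V t y \<le> ereal d" "d < e"
  shows "\<exists>\<^sub>F h in at_right 0. (V (t + h) (S h y) - V t y) / h < e"
proof (rule ccontr)
  assume "\<not> ?thesis"
  then have "\<forall>\<^sub>F h in at_right 0. ereal e \<le> ereal ((V (t + h) (S h y) - V t y) / h)"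
    by (simp add: not_frequently not_less)
  then have "ereal e \<le> lower_Dini S V t y"
    unfolding lower_Dini_def by (rule Liminf_bounded)
  with assms show False
    using order_trans[of "ereal e" "lower_Dini S V t y" "ereal d"] by simp
qed

text \<open>Integration of the Dini inequality between impulses. With a slope \<open>\<epsilon>\<close> to spare, the
  functional plus the energy spent, minus \<open>\<epsilon>\<close> times the elapsed time, has arbitrarily small descending
  steps at every point, so \<open>le_of_local_descent\<close> applies; then \<open>\<epsilon>\<close> tends to \<open>0\<close>.\<close>

lemma lyapunov_flow_decrease:
  assumes p: "1 \<le> p" and lyap: "lyapunov_functional S J \<sigma> p c V"
    and s: "\<sigma> l \<le> s" "s \<le> r" "r < \<sigma> (Suc l)"
  shows "V r (S (r - s) x) + flow_energy p x (r - s) \<le> V s x"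
proof (rule field_le_epsilon)
  let ?\<Phi> = "flow_energy p x"
  let ?f = "\<lambda>t. V t (S (t - s) x)"
  let ?T = "\<sigma> (Suc l) - \<sigma> l"
  have s0: "0 \<le> s"
    using s(1) sigma_nonneg[of l] by linarith
  have V_lipschitz: "lipschitz_on_bounded V"
    using lyap by (simp add: lyapunov_functional_def)
  have V_cont: "continuous_on {s..r} (\<lambda>t. V t y)" for y
  proof (rule continuous_on_subset)
    show "continuous_on {\<sigma> l..<\<sigma> (Suc l)} (\<lambda>t. V t y)"
      using lyap by (simp add: lyapunov_functional_def piecewise_right_continuous_def)
  qed (use s in auto)
  have flow_cont: "continuous_on {s..r} (\<lambda>t. S (t - s) x)"
    by (rule continuous_on_subset[OF continuous_on_S_shift[OF s(1)]]) (use s in auto)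
  have f_cont: "continuous_on {s..r} ?f"
    unfolding continuous_on_def
  proof
    fix t assume t: "t \<in> {s..r}"
    show "(?f \<longlongrightarrow> ?f t) (at t within {s..r})"
    proof (rule lipschitz_on_bounded_tendsto[OF V_lipschitz, where g = "\<lambda>\<tau>. \<tau>"])
      show "((\<lambda>t. S (t - s) x) \<longlongrightarrow> S (t - s) x) (at t within {s..r})"
        using flow_cont t unfolding continuous_on_def by (rule bspec)
      show "((\<lambda>\<tau>. V \<tau> (S (t - s) x)) \<longlongrightarrow> ?f t) (at t within {s..r})"
        using V_cont t unfolding continuous_on_def by (rule bspec)
      show "\<forall>\<^sub>F \<tau> in at t within {s..r}. 0 \<le> \<tau>"
        unfolding eventually_at_filter using s0 by (intro always_eventually) auto
    qed
  qed
  have \<Phi>_cont: "continuous_on {s..r} (\<lambda>t. ?\<Phi> (t - s))"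
  proof (rule continuous_on_compose2[OF continuous_on_flow_energy[OF p, of l]])
    show "continuous_on {s..r} (\<lambda>t. t - s)"
      by (intro continuous_intros)
  qed (use s in auto)
  fix e :: real assume e: "0 < e"
  \<comment> \<open>The summand \<open>1\<close> keeps the denominator positive when \<open>r = s\<close>.\<close>
  define \<epsilon> where "\<epsilon> = e / (r - s + 1)"
  have \<epsilon>: "0 < \<epsilon>" using e s(2) by (simp add: \<epsilon>_def)
  define \<psi> where "\<psi> = (\<lambda>t. ?f t + ?\<Phi> (t - s) - \<epsilon> * (t - s))"
  have "\<psi> r \<le> \<psi> s"
  proof (rule le_of_local_descent[OF s(2)])
    show "continuous_on {s..r} \<psi>"
      unfolding \<psi>_def by (intro continuous_on_add continuous_on_diff continuous_on_mult_left f_cont \<Phi>_cont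
        continuous_on_id continuous_on_const)
    fix t assume t: "s \<le> t" "t < r"
    let ?y = "S (t - s) x"
    let ?q = "norm ?y powr p"
    have "lower_Dini S V t ?y \<le> ereal (- ?q)"
      using lyap t s0 by (simp add: lyapunov_functional_def)
    from lower_Dini_le_imp_frequently[OF this, of "- ?q + \<epsilon> / 2"]
    have "\<exists>\<^sub>F h in at_right 0. (V (t + h) (S h ?y) - V t ?y) / h < - ?q + \<epsilon> / 2"
      using \<epsilon> by simp
    moreover have "\<forall>\<^sub>F h in at_right 0. (?\<Phi> (h + (t - s)) - ?\<Phi> (t - s)) / h < ?q + \<epsilon> / 2"
      by (rule order_tendstoD(2)[OF flow_energy_right_derivative[OF p, of _ l]]) (use t s \<epsilon> in auto)
    moreover have "\<forall>\<^sub>F h in at_right 0. h \<in> {0<..<r - t}"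
      by (rule eventually_at_right_real) (use t in simp)
    ultimately have "\<exists>\<^sub>F h in at_right 0. (V (t + h) (S h ?y) - V t ?y) / h < - ?q + \<epsilon> / 2 \<and>
        (?\<Phi> (h + (t - s)) - ?\<Phi> (t - s)) / h < ?q + \<epsilon> / 2 \<and> h \<in> {0<..<r - t}"
      by (intro frequently_eventually_frequently[OF _ eventually_conj])
    from frequently_ex[OF this] obtain h where h: "0 < h" "h < r - t"
        "(V (t + h) (S h ?y) - V t ?y) / h < - ?q + \<epsilon> / 2"
        "(?\<Phi> (h + (t - s)) - ?\<Phi> (t - s)) / h < ?q + \<epsilon> / 2"
      by auto
    have "V (t + h) (S h ?y) - V t ?y < (- ?q + \<epsilon> / 2) * h"
      "?\<Phi> (h + (t - s)) - ?\<Phi> (t - s) < (?q + \<epsilon> / 2) * h"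
      using h by (simp_all only: pos_divide_less_eq)
    moreover have "(- ?q + \<epsilon> / 2) * h + (?q + \<epsilon> / 2) * h = \<epsilon> * h"
      by (simp add: algebra_simps)
    moreover have "S (t + h - s) x = S h ?y"
      using S_add[of h "t - s"] h(1) t(1) by (simp add: algebra_simps)
    moreover have "h + (t - s) = t + h - s" "\<epsilon> * (t + h - s) = \<epsilon> * (t - s) + \<epsilon> * h"
      by (simp_all add: algebra_simps)
    ultimately have "\<psi> (t + h) \<le> \<psi> t"
      unfolding \<psi>_def by simp
    then show "\<exists>h>0. t + h \<le> r \<and> \<psi> (t + h) \<le> \<psi> t"
      using h(1,2) by (intro exI[of _ h]) auto
  qed
  moreover have "\<epsilon> * (r - s) \<le> e"
    using e s(2) by (simp add: \<epsilon>_def field_simps)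
  ultimately show "V r (S (r - s) x) + flow_energy p x (r - s) \<le> V s x + e"
    by (simp add: \<psi>_def)
qed

text \<open>The decrease along the flow passes to the left limit at the impulse time, where the jump
  condition takes over.\<close>

lemma lyapunov_jump_decrease:
  assumes p: "1 \<le> p" and lyap: "lyapunov_functional S J \<sigma> p c V"
    and s: "\<sigma> l \<le> s" "s < \<sigma> (Suc l)"
  defines "b \<equiv> \<sigma> (Suc l)"
  shows "V b (J (S (b - s) x)) + norm (S (b - s) x) powr p + flow_energy p x (b - s) \<le> V s x"
proof -
  let ?y = "S (b - s) x"
  have s0: "0 \<le> s"
    using s(1) sigma_nonneg[of l] by linarith
  have sb: "s < b"
    unfolding b_def by (rule s(2))
  have b: "b \<in> impulse_times \<sigma>"
    by (auto simp: b_def impulse_times_def)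
  then obtain v where v: "((\<lambda>t. V t ?y) \<longlongrightarrow> v) (at_left b)"
    using lyap unfolding lyapunov_functional_def piecewise_right_continuous_def by blast
  have dwell: "\<forall>\<^sub>F t in at_left b. t \<in> {s<..<b}"
    by (rule eventually_at_left_real[OF sb])
  have "((\<lambda>t. V t (S (t - s) x)) \<longlongrightarrow> v) (at_left b)"
  proof (rule lipschitz_on_bounded_tendsto[where V = V and g = "\<lambda>t. t" and y = ?y])
    show "((\<lambda>t. V t ?y) \<longlongrightarrow> v) (at_left b)" by (rule v)
    show "lipschitz_on_bounded V"
      using lyap by (simp add: lyapunov_functional_def)
    show "((\<lambda>t. S (t - s) x) \<longlongrightarrow> ?y) (at_left b)"
      unfolding b_def by (rule left_limit_S[OF s])
    show "\<forall>\<^sub>F t in at_left b. 0 \<le> t"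
      using dwell by eventually_elim (use s0 in simp)
  qed
  moreover have "((\<lambda>t. flow_energy p x (t - s)) \<longlongrightarrow> flow_energy p x (b - s)) (at_left b)"
  proof -
    have "continuous_on {s..b} (\<lambda>t. flow_energy p x (t - s))"
    proof (rule continuous_on_compose2[OF continuous_on_flow_energy[OF p, of l]])
      show "continuous_on {s..b} (\<lambda>t. t - s)"
        by (intro continuous_intros)
    qed (use s in \<open>auto simp: b_def\<close>)
    then have "((\<lambda>t. flow_energy p x (t - s)) \<longlongrightarrow> flow_energy p x (b - s)) (at b within {s..b})"
      unfolding continuous_on_def by (rule bspec) (use sb in simp)
    then show ?thesis
      unfolding at_within_Icc_at_left[OF sb] .
  qed
  ultimately have "((\<lambda>t. V t (S (t - s) x) + flow_energy p x (t - s)) \<longlongrightarrow> v + flow_energy p x (b - s)) (at_left b)"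
    by (rule tendsto_add)
  moreover have "\<forall>\<^sub>F t in at_left b. V t (S (t - s) x) + flow_energy p x (t - s) \<le> V s x"
    using dwell
  proof eventually_elim
    case (elim t)
    then show ?case
      by (intro lyapunov_flow_decrease[OF p lyap s(1)]) (auto simp: b_def)
  qed
  ultimately have "v + flow_energy p x (b - s) \<le> V s x"
    by (rule tendsto_upperbound) simp
  moreover have "V b (J ?y) - v \<le> - (norm ?y powr p)"
  proof -
    have "Lim (at_left b) (\<lambda>t. V t ?y) = v"
      using v by (intro tendsto_Lim) auto
    moreover have "V b (J ?y) - Lim (at_left b) (\<lambda>t. V t ?y) \<le> - (norm ?y powr p)"
      using lyap b unfolding lyapunov_functional_def by blast
    ultimately show ?thesis by simp
  qed
  ultimately show ?thesis by linarith
qed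

lemma lyapunov_stage_decrease:
  assumes p: "1 \<le> p" and lyap: "lyapunov_functional S J \<sigma> p c V"
    and s: "\<sigma> l \<le> s" "s < \<sigma> (Suc l)"
  defines "b \<equiv> \<sigma> (Suc l)"
  shows "(\<integral>\<^sup>+ t\<in>{s..<b}. ennreal (norm (U t s x) powr p) \<partial>lborel) +
    ennreal (norm (U_left b s x) powr p) + ennreal (V b (U b s x)) \<le> ennreal (V s x)"
proof -
  have "s \<le> b" using s(2) unfolding b_def by linarith
  have V_nonneg: "0 \<le> V b y" for y
    using lyap by (simp add: lyapunov_functional_def b_def)
  have "(\<integral>\<^sup>+ t\<in>{s..<b}. ennreal (norm (U t s x) powr p) \<partial>lborel) = ennreal (flow_energy p x (b - s))"
    by (rule nn_integral_within_dwell[OF p s(1) \<open>s \<le> b\<close>]) (simp add: b_def)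
  moreover have "U_left b s x = S (b - s) x"
    unfolding b_def by (rule propagator_left_dwell[OF s])
  moreover have "U b s x = J (S (b - s) x)"
    unfolding b_def by (rule propagator_jump[OF s])
  moreover have "ennreal (flow_energy p x (b - s)) + ennreal (norm (S (b - s) x) powr p) +
      ennreal (V b (J (S (b - s) x))) =
      ennreal (flow_energy p x (b - s) + norm (S (b - s) x) powr p + V b (J (S (b - s) x)))"
    by (simp add: flow_energy_nonneg V_nonneg)
  moreover have "flow_energy p x (b - s) + norm (S (b - s) x) powr p + V b (J (S (b - s) x)) \<le> V s x"
    using lyapunov_jump_decrease[OF p lyap s, of x] unfolding b_def by linarith
  ultimately show ?thesis
    by (simp only: ennreal_leI)
qed

text \<open>The decreases over successive dwell intervals telescope, and the remaining value of \<open>V\<close> is nonnegative.\<close>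

lemma cost_le_lyapunov:
  assumes p: "1 \<le> p" and lyap: "lyapunov_functional S J \<sigma> p c V" and s: "0 \<le> s"
  shows "cost p s x \<le> ennreal (V s x)"
proof -
  obtain l where l: "\<sigma> l \<le> s" "s < \<sigma> (Suc l)"
    using dwell_index[OF s] .
  let ?I = "\<lambda>B. \<integral>\<^sup>+ t\<in>B. ennreal (norm (U t s x) powr p) \<partial>lborel"
  let ?g = "\<lambda>k. ennreal (norm (U_left (\<sigma> k) s x) powr p)"
  let ?V = "\<lambda>n. ennreal (V (\<sigma> n) (U (\<sigma> n) s x))"
  have stages: "?I {s..<\<sigma> n} + sum ?g {l<..n} + ?V n \<le> ennreal (V s x)" if "Suc l \<le> n" for n
    using that
  proof (induction n rule: nat_induct_at_least)
    case base
    have "{l<..Suc l} = {Suc l}" by auto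
    then show ?case
      using lyapunov_stage_decrease[OF p lyap l, of x] by simp
  next
    case (Suc n)
    let ?y = "U (\<sigma> n) s x"
    have sn: "s \<le> \<sigma> n" "\<sigma> n \<le> \<sigma> (Suc n)" "\<sigma> n < \<sigma> (Suc n)"
      using dwell_less_iff[OF l, of n] Suc.hyps by auto
    have integral: "?I {s..<\<sigma> (Suc n)} = ?I {s..<\<sigma> n} +
        (\<integral>\<^sup>+ t\<in>{\<sigma> n..<\<sigma> (Suc n)}. ennreal (norm (U t (\<sigma> n) ?y) powr p) \<partial>lborel)"
    proof -
      have "?I ({s..<\<sigma> n} \<union> {\<sigma> n..<\<sigma> (Suc n)}) = ?I {s..<\<sigma> n} + ?I {\<sigma> n..<\<sigma> (Suc n)}"
        by (rule nn_integral_propagator_Un[OF s]) (use sn in auto)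
      moreover have "{s..<\<sigma> n} \<union> {\<sigma> n..<\<sigma> (Suc n)} = {s..<\<sigma> (Suc n)}"
        by (rule ivl_disj_un_two(3)[OF sn(1,2)])
      moreover have "?I {\<sigma> n..<\<sigma> (Suc n)} =
          (\<integral>\<^sup>+ t\<in>{\<sigma> n..<\<sigma> (Suc n)}. ennreal (norm (U t (\<sigma> n) ?y) powr p) \<partial>lborel)"
      proof (rule nn_integral_cong)
        fix t
        show "ennreal (norm (U t s x) powr p) * indicator {\<sigma> n..<\<sigma> (Suc n)} t =
            ennreal (norm (U t (\<sigma> n) ?y) powr p) * indicator {\<sigma> n..<\<sigma> (Suc n)} t"
          using propagator_cocycle_apply[OF sn(1), of t x] by (cases "\<sigma> n \<le> t") (simp_all only:, simp)
      qed
      ultimately show ?thesis by (simp only:)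
    qed
    have "{l<..Suc n} = insert (Suc n) {l<..n}"
      using Suc.hyps by auto
    moreover have "sum ?g (insert (Suc n) {l<..n}) = ?g (Suc n) + sum ?g {l<..n}"
      by (rule sum.insert) auto
    ultimately have sum: "sum ?g {l<..Suc n} =
        sum ?g {l<..n} + ennreal (norm (U_left (\<sigma> (Suc n)) (\<sigma> n) ?y) powr p)"
      using propagator_left_cocycle[OF s sn(1) sn(3), of x] by (simp only: add.commute)
    have "?V (Suc n) = ennreal (V (\<sigma> (Suc n)) (U (\<sigma> (Suc n)) (\<sigma> n) ?y))"
      using propagator_cocycle_apply[OF sn(1,2), of x] by (simp only:)
    then have "?I {s..<\<sigma> (Suc n)} + sum ?g {l<..Suc n} + ?V (Suc n) =
        ?I {s..<\<sigma> n} + sum ?g {l<..n} +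
        ((\<integral>\<^sup>+ t\<in>{\<sigma> n..<\<sigma> (Suc n)}. ennreal (norm (U t (\<sigma> n) ?y) powr p) \<partial>lborel) +
          ennreal (norm (U_left (\<sigma> (Suc n)) (\<sigma> n) ?y) powr p) +
          ennreal (V (\<sigma> (Suc n)) (U (\<sigma> (Suc n)) (\<sigma> n) ?y)))"
      unfolding integral sum by (simp only: ac_simps)
    also have "\<dots> \<le> ?I {s..<\<sigma> n} + sum ?g {l<..n} + ?V n"
      by (intro add_left_mono lyapunov_stage_decrease[OF p lyap order_refl sn(3)])
    also note Suc.IH
    finally show ?case .
  qed
  show ?thesis
  proof (rule cost_le[OF l])
    fix n assume "l < n"
    then have "?I {s..<\<sigma> n} + sum ?g {l<..n} + ?V n \<le> ennreal (V s x)"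
      by (intro stages) simp
    then show "?I {s..<\<sigma> n} + sum ?g {l<..n} \<le> ennreal (V s x)"
      by (rule order_trans[rotated]) (simp add: add_increasing2)
  qed
qed

end

section \<open>A bounded cost forces exponential decay\<close>

context impulsive_system
begin

lemma impulse_count_shift:
  assumes "\<sigma> l \<le> s" "s < \<sigma> (Suc l)"
  shows "impulse_count \<sigma> (\<sigma> (l + N)) s = N"
  using impulse_count_eq[OF assms, of "l + N" "\<sigma> (l + N)"] by simp

text \<open>The state at \<open>t\<close> arises from the state before the last impulse by \<open>J\<close> and a flow shorter than
  a dwell time, or, before the first impulse, from \<open>x\<close> by such a flow.\<close>

lemma bounded_propagator_of_bounded_left:
  assumes s: "0 \<le> s" "s \<le> t" and "0 \<le> b"
    and left: "\<And>k. s < \<sigma> (Suc k) \<Longrightarrow> norm (U_left (\<sigma> (Suc k)) s x) \<le> b * norm x"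
  shows "norm (U t s x) \<le> K * max 1 (norm J * b) * norm x"
proof -
  let ?c = "max 1 (norm J * b)"
  obtain l where l: "\<sigma> l \<le> s" "s < \<sigma> (Suc l)"
    using dwell_index[OF s(1)] .
  obtain m where m: "\<sigma> m \<le> t" "t < \<sigma> (Suc m)"
    using dwell_index[of t] s by auto
  have S_le: "norm (S (t - r) y) \<le> K * norm y" if "\<sigma> m \<le> r" "r \<le> t" for r y
    using that m dwell_bound[of "t - r" m]
    by (intro order_trans[OF norm_blinfun] mult_right_mono) auto
  show ?thesis
  proof (cases "\<sigma> m \<le> s")
    case True
    then have "U t s x = S (t - s) x"
      using propagator_dwell[OF _ s(2) m(2)] by simp
    then have "norm (U t s x) \<le> K * norm x"
      using S_le[OF True s(2)] by simp
    also have "\<dots> \<le> K * ?c * norm x"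
      using K_ge_1 by (intro mult_right_mono) auto
    finally show ?thesis .
  next
    case False
    then obtain k where k: "m = Suc k"
      using s(1) by (cases m) (auto simp: sigma_0)
    have "norm (U (\<sigma> m) s x) \<le> norm J * norm (U_left (\<sigma> m) s x)"
      using propagator_jump_left[OF s(1), of k x] False norm_blinfun[of J] unfolding k by simp
    also have "\<dots> \<le> norm J * (b * norm x)"
      using left[of k] False unfolding k by (intro mult_left_mono) auto
    also have "\<dots> \<le> ?c * norm x"
      by (simp add: mult_right_mono flip: mult.assoc)
    finally have jump: "norm (U (\<sigma> m) s x) \<le> ?c * norm x" .
    have "U t s x = S (t - \<sigma> m) (U (\<sigma> m) s x)"
      using propagator_within_dwell[of s "\<sigma> m" m t x] False m by simp
    then have "norm (U t s x) \<le> K * norm (U (\<sigma> m) s x)"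
      using S_le[OF order_refl m(1)] by simp
    also have "\<dots> \<le> K * (?c * norm x)"
      using jump K_ge_1 by (intro mult_left_mono) auto
    finally show ?thesis by (simp add: mult.assoc)
  qed
qed

text \<open>Time and impulses are counted together in \<open>\<theta>\<close>, so that a single halving argument yields decay in both;
  the impulse factor is then \<open>\<rho> = exp (- \<alpha>)\<close>.\<close>

lemma propagator_decay_of_cost_bound:
  assumes p: "1 \<le> p" and b: "0 < b"
    and datko: "\<And>s x. 0 \<le> s \<Longrightarrow> cost p s x \<le> ennreal (b powr p * norm x powr p)"
  shows "\<exists>M \<alpha>. 1 \<le> M \<and> 0 < \<alpha> \<and> (\<forall>s\<ge>0. \<forall>t\<ge>s. norm (U t s)
    \<le> M * exp (- \<alpha>) ^ impulse_count \<sigma> t s * exp (- \<alpha> * (t - s)))"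
proof -
  have left: "norm (U_left (\<sigma> (Suc k)) s x) \<le> b * norm x" if "0 \<le> s" "s < \<sigma> (Suc k)" for k s x
  proof -
    obtain l where l: "\<sigma> l \<le> s" "s < \<sigma> (Suc l)"
      using dwell_index[OF \<open>0 \<le> s\<close>] .
    then have "Suc k \<in> {l<..Suc k}"
      using dwell_less_iff[OF l, of "Suc k"] that by simp
    then have "ennreal (norm (U_left (\<sigma> (Suc k)) s x) powr p) \<le>
        (\<Sum>j\<in>{l<..Suc k}. ennreal (norm (U_left (\<sigma> j) s x) powr p))"
      by (rule member_le_sum) auto
    also have "\<dots> \<le> cost p s x"
      using cost_ge[OF l, of "{}" x p "Suc k"] by simp
    also have "\<dots> \<le> ennreal (b powr p * norm x powr p)"
      by (rule datko[OF \<open>0 \<le> s\<close>])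
    finally have "norm (U_left (\<sigma> (Suc k)) s x) powr p \<le> (b * norm x) powr p"
      using b by (simp add: powr_mult)
    then show ?thesis
      by (rule powr_le_imp_le) (use p b in auto)
  qed
  define K1 where "K1 = K * max 1 (norm J * b)"
  have "1 * 1 \<le> K * max 1 (norm J * b)"
    using K_ge_1 by (intro mult_mono) auto
  then have K1: "1 \<le> K1" by (simp add: K1_def)
  have U_le: "norm (U t s x) \<le> K1 * norm x" if "0 \<le> s" "s \<le> t" for s t x
    unfolding K1_def
    by (rule bounded_propagator_of_bounded_left[OF that]) (use b left that in auto)
  \<comment> \<open>In comparing the final state with a state just before an impulse, \<open>J\<close> costs another factor.\<close>
  define K2 where "K2 = K1 * max 1 (norm J)"
  have "1 * 1 \<le> K1 * max 1 (norm J)"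
    using K1 by (intro mult_mono) auto
  then have K2: "1 \<le> K2" by (simp add: K2_def)
  define \<theta> where "\<theta> = (\<lambda>t s. (t - s) + real (impulse_count \<sigma> t s))"
  have elapsed: "\<theta> t s * (norm (U t s x) / K2) powr p \<le> (b * norm x) powr p"
    if "0 \<le> s" "s \<le> t" for s t x
  proof -
    define w where "w = norm (U t s x) / K2"
    have w: "0 \<le> w" using K2 by (simp add: w_def)
    obtain l where l: "\<sigma> l \<le> s" "s < \<sigma> (Suc l)"
      using dwell_index[OF \<open>0 \<le> s\<close>] .
    obtain m where m: "\<sigma> m \<le> t" "t < \<sigma> (Suc m)"
      using dwell_index[of t] \<open>0 \<le> s\<close> \<open>s \<le> t\<close> by auto
    have "K1 * 1 \<le> K2" "K1 * norm J \<le> K2"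
      unfolding K2_def using K1 by (auto intro!: mult_left_mono)
    \<comment> \<open>The final state, scaled by the uniform bound, is dominated by all earlier states, also by
      those just before impulses.\<close>
    have flow: "w \<le> norm (U \<tau> s x)" if "\<tau> \<in> {s..t}" for \<tau>
    proof -
      have "norm (U t s x) \<le> K1 * norm (U \<tau> s x)"
        using U_le[of \<tau> t "U \<tau> s x"] propagator_cocycle_apply[of s \<tau> t x] that \<open>0 \<le> s\<close> by simp
      also have "\<dots> \<le> K2 * norm (U \<tau> s x)"
        using \<open>K1 * 1 \<le> K2\<close> by (intro mult_right_mono) auto
      finally show ?thesis
        using K2 by (simp add: w_def divide_le_eq mult.commute)
    qed
    have jump: "w \<le> norm (U_left (\<sigma> k) s x)" if "k \<in> {l<..m}" for k
    proof -
      obtain j where j: "k = Suc j"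
        using \<open>k \<in> {l<..m}\<close> by (cases k) auto
      have sk: "s < \<sigma> (Suc j)" "\<sigma> (Suc j) \<le> t"
        using dwell_less_iff[OF l, of k] dwell_less_iff[OF m, of k] \<open>k \<in> {l<..m}\<close> unfolding j
        by auto
      have "norm (U t s x) \<le> K1 * norm (U (\<sigma> k) s x)"
        using U_le[of "\<sigma> k" t "U (\<sigma> k) s x"] propagator_cocycle_apply[of s "\<sigma> k" t x] sk j by simp
      also have "\<dots> \<le> K1 * (norm J * norm (U_left (\<sigma> k) s x))"
        using propagator_jump_left[OF \<open>0 \<le> s\<close> sk(1), of x] K1 norm_blinfun[of J] j
        by (intro mult_left_mono) auto
      also have "\<dots> \<le> K2 * norm (U_left (\<sigma> k) s x)"
        using mult_right_mono[OF \<open>K1 * norm J \<le> K2\<close>, of "norm (U_left (\<sigma> k) s x)"]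
        by (simp add: mult.assoc)
      finally show ?thesis
        using K2 by (simp add: w_def divide_le_eq mult.commute)
    qed
    have "ennreal (w powr p) * ennreal (t - s) = (\<integral>\<^sup>+ \<tau>\<in>{s..t}. ennreal (w powr p) \<partial>lborel)"
      using \<open>s \<le> t\<close> by (simp add: nn_integral_cmult_indicator)
    also have "\<dots> \<le> (\<integral>\<^sup>+ \<tau>\<in>{s..t}. ennreal (norm (U \<tau> s x) powr p) \<partial>lborel)"
    proof (rule nn_integral_mono)
      fix \<tau>
      show "ennreal (w powr p) * indicator {s..t} \<tau> \<le> ennreal (norm (U \<tau> s x) powr p) * indicator {s..t} \<tau>"
        using flow[of \<tau>] w p by (auto intro!: ennreal_leI powr_mono2 split: split_indicator)
    qed
    finally have int: "ennreal (w powr p * (t - s)) \<le> (\<integral>\<^sup>+ \<tau>\<in>{s..t}. ennreal (norm (U \<tau> s x) powr p) \<partial>lborel)"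
      using \<open>s \<le> t\<close> by (simp add: ennreal_mult)
    have "(\<Sum>k\<in>{l<..m}. w powr p) \<le> (\<Sum>k\<in>{l<..m}. norm (U_left (\<sigma> k) s x) powr p)"
      using jump w p by (intro sum_mono powr_mono2) auto
    then have "w powr p * real (impulse_count \<sigma> t s) \<le> (\<Sum>k\<in>{l<..m}. norm (U_left (\<sigma> k) s x) powr p)"
      unfolding impulse_count_eq[OF l m] by (simp add: mult.commute)
    then have sum: "ennreal (w powr p * real (impulse_count \<sigma> t s)) \<le>
        (\<Sum>k\<in>{l<..m}. ennreal (norm (U_left (\<sigma> k) s x) powr p))"
      by (simp add: ennreal_leI)
    have "ennreal (\<theta> t s * w powr p) = ennreal (w powr p * (t - s)) + ennreal (w powr p * real (impulse_count \<sigma> t s))"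
      using \<open>s \<le> t\<close>
      by (subst ennreal_plus[symmetric]) (auto simp: \<theta>_def algebra_simps intro: mult_right_mono)
    also have "\<dots> \<le> cost p s x"
      by (rule order_trans[OF add_mono[OF int sum] cost_ge[OF l]]) auto
    also have "\<dots> \<le> ennreal (b powr p * norm x powr p)"
      by (rule datko[OF \<open>0 \<le> s\<close>])
    finally show ?thesis
      unfolding w_def using b by (simp add: powr_mult)
  qed
  obtain N0 where N0: "(2 * K2 * b) powr p \<le> real N0"
    using real_arch_simple by blast
  define N where "N = Suc N0"
  have N: "(2 * K2 * b) powr p \<le> real N" "0 < N"
    using N0 by (auto simp: N_def)
  have contraction: "norm (U t s) \<le> 1 / 2" if "0 \<le> s" "s \<le> t" "real N \<le> \<theta> t s" for s t
  proof (rule norm_blinfun_bound)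
    fix x
    have "2 * b * norm (U t s x) = 2 * K2 * b * (norm (U t s x) / K2)"
      using K2 by (simp add: field_simps)
    then have "(2 * b * norm (U t s x)) powr p = (2 * K2 * b * (norm (U t s x) / K2)) powr p"
      by (simp only:)
    also have "\<dots> = (2 * K2 * b) powr p * (norm (U t s x) / K2) powr p"
      using K2 b by (subst powr_mult) auto
    also have "\<dots> \<le> \<theta> t s * (norm (U t s x) / K2) powr p"
      using N(1) that(3) by (intro mult_right_mono) auto
    also have "\<dots> \<le> (b * norm x) powr p"
      by (rule elapsed[OF that(1,2)])
    finally have "2 * b * norm (U t s x) \<le> b * norm x"
      by (rule powr_le_imp_le) (use p b in auto)
    then have "b * (2 * norm (U t s x)) \<le> b * norm x"
      by (simp add: ac_simps)
    then show "norm (U t s x) \<le> 1 / 2 * norm x"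
      using b by simp
  qed simp
  have \<theta>_add: "\<theta> t s = \<theta> r s + \<theta> t r" if "s \<le> r" "r \<le> t" for s r t
    using impulse_count_add[OF that] by (simp add: \<theta>_def)
  have iterate: "norm (U t s) \<le> K1 * (1 / 2) ^ n"
    if "0 \<le> s" "s \<le> t" "2 * real N * real n \<le> \<theta> t s" for n s t
    using that
  proof (induction n arbitrary: s)
    case 0
    then show ?case
      using U_le K1 by (intro norm_blinfun_bound) auto
  next
    case (Suc n)
    obtain l where l: "\<sigma> l \<le> s" "s < \<sigma> (Suc l)"
      using dwell_index[OF Suc.prems(1)] .
    \<comment> \<open>Stop as soon as either clock has advanced by \<open>N\<close>. Then \<open>\<theta>\<close> has advanced by at least \<open>N\<close>,
      which halves the norm, and by at most \<open>2 N\<close>, although an impulse lets \<open>\<theta>\<close> jump.\<close>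
    define r where "r = min (s + real N) (\<sigma> (l + N))"
    have "s < \<sigma> (l + N)"
      using dwell_less_iff[OF l] N(2) by simp
    then have sr: "s \<le> r"
      by (simp add: r_def)
    have "impulse_count \<sigma> (\<sigma> (l + N)) s = impulse_count \<sigma> r s + impulse_count \<sigma> (\<sigma> (l + N)) r"
      using sr by (intro impulse_count_add) (auto simp: r_def)
    then have count_r: "impulse_count \<sigma> r s \<le> N"
      using impulse_count_shift[OF l, of N] by simp
    have \<theta>_le: "\<theta> r s \<le> 2 * real N"
      using count_r by (simp add: \<theta>_def r_def)
    have \<theta>_ge: "real N \<le> \<theta> r s"
    proof (cases "r = \<sigma> (l + N)")
      case True
      then show ?thesis
        using impulse_count_shift[OF l, of N] sr by (simp add: \<theta>_def)
    next
      case False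
      then have "r = s + real N" by (auto simp: r_def min_def split: if_splits)
      then show ?thesis by (simp add: \<theta>_def)
    qed
    have "r \<le> t"
    proof (rule ccontr)
      assume "\<not> r \<le> t"
      then have "\<theta> r s = \<theta> t s + \<theta> r t" "0 \<le> real (impulse_count \<sigma> r t)" "t < r"
        using \<theta>_add[of s t r] Suc.prems(2) by auto
      moreover have "2 * real N \<le> 2 * real N * real (Suc n)"
        by (simp add: algebra_simps)
      ultimately show False
        using \<theta>_le Suc.prems(3) by (simp add: \<theta>_def)
    qed
    have "2 * real N * real n + 2 * real N \<le> \<theta> t s"
      using Suc.prems(3) by (simp add: algebra_simps)
    then have "2 * real N * real n \<le> \<theta> t r"
      using \<theta>_add[OF sr \<open>r \<le> t\<close>] \<theta>_le by linarith
    then have "norm (U t r) \<le> K1 * (1 / 2) ^ n"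
      using Suc.IH[of r] Suc.prems(1) sr \<open>r \<le> t\<close> by simp
    moreover have "norm (U r s) \<le> 1 / 2"
      by (rule contraction[OF Suc.prems(1) sr \<theta>_ge])
    ultimately have "norm (U t r) * norm (U r s) \<le> (K1 * (1 / 2) ^ n) * (1 / 2)"
      using K1 by (intro mult_mono) auto
    then show ?case
      using norm_blinfun_compose[of "U t r" "U r s"] propagator_cocycle[OF sr \<open>r \<le> t\<close>] by simp
  qed
  \<comment> \<open>The norm halves each time \<open>\<theta>\<close> grows by \<open>2 N\<close>; rounding \<open>\<theta> / (2 N)\<close> down to an integer costs a factor \<open>2\<close>.\<close>
  define \<alpha> where "\<alpha> = ln 2 / (2 * real N)"
  have \<alpha>: "0 < \<alpha>" using N(2) by (simp add: \<alpha>_def)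
  have "norm (U t s) \<le> 2 * K1 * exp (- \<alpha>) ^ impulse_count \<sigma> t s * exp (- \<alpha> * (t - s))"
    if "0 \<le> s" "s \<le> t" for s t
  proof -
    have \<theta>: "0 \<le> \<theta> t s" using that by (simp add: \<theta>_def)
    define n where "n = nat \<lfloor>\<theta> t s / (2 * real N)\<rfloor>"
    have n: "real n \<le> \<theta> t s / (2 * real N)" "\<theta> t s / (2 * real N) < real n + 1"
      using \<theta> unfolding n_def by (auto simp: of_nat_nat)
    then have "norm (U t s) \<le> K1 * (1 / 2) ^ n"
      using N(2) by (intro iterate[OF that]) (simp add: field_simps)
    also have "(1 / 2 :: real) ^ n = exp (- (ln 2 * real n))"
      by (simp add: exp_minus exp_of_nat_mult mult.commute[of "ln 2"] power_one_over inverse_eq_divide)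
    also have "\<dots> \<le> exp (ln 2 - \<alpha> * \<theta> t s)"
    proof -
      have "ln 2 * (\<theta> t s / (2 * real N)) \<le> ln 2 * (real n + 1)"
        using n(2) by (intro mult_left_mono) auto
      then show ?thesis by (simp add: \<alpha>_def algebra_simps)
    qed
    also have "\<dots> = 2 * (exp (- \<alpha>) ^ impulse_count \<sigma> t s * exp (- \<alpha> * (t - s)))"
    proof -
      have "ln 2 - \<alpha> * \<theta> t s = ln 2 + (real (impulse_count \<sigma> t s) * (- \<alpha>) + (- \<alpha> * (t - s)))"
        by (simp add: \<theta>_def algebra_simps)
      then show ?thesis
        by (simp only: exp_add exp_of_nat_mult exp_ln[OF zero_less_numeral])
    qed
    finally show ?thesis
      using K1 by (simp add: mult_ac)
  qed
  then show ?thesis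
    using K1 \<alpha> by (intro exI[of _ "2 * K1"] exI[of _ \<alpha>]) auto
qed

end

section \<open>The equivalence\<close>

text \<open>For \<open>\<tau>\<close> strictly below some dwell time, \<open>S \<tau>\<close> is a propagator without impulses, and the growth condition
  bounds it by \<open>L = max 1 G\<close>, where \<open>G\<close> bounds \<open>g\<close>. The supremal dwell time may be attained, and \<open>\<tau>\<close> may equal it; since
  \<open>S \<tau>\<close> is the square of \<open>S (\<tau> / 2)\<close>, the constant \<open>L * L\<close> covers this case as well.\<close>

lemma growth_condition_imp_impulsive_system:
  assumes S: "C0_semigroup S" and \<sigma>: "\<sigma> \<in> impulse_sequences" and growth: "growth_condition S J \<sigma>"
  obtains K where "impulsive_system \<sigma> S K"
proof -
  interpret impulse_sequence \<sigma>
    by unfold_locales (rule \<sigma>)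
  obtain g \<mu> where g: "\<And>s t x. 0 \<le> s \<Longrightarrow> s \<le> t \<Longrightarrow>
        norm (propagator S J \<sigma> t s x) \<le> g (t - s) * \<mu> ^ impulse_count \<sigma> t s * norm x"
      "bdd_above (g ` {\<tau>. 0 \<le> \<tau> \<and> ereal \<tau> < sup_dwell \<sigma>})"
    using growth unfolding growth_condition_def by blast
  obtain G where G: "\<And>\<tau>. 0 \<le> \<tau> \<Longrightarrow> ereal \<tau> < sup_dwell \<sigma> \<Longrightarrow> g \<tau> \<le> G"
    using g(2) unfolding bdd_above_def by blast
  define L where "L = max 1 G"
  have inner: "norm (S \<tau>) \<le> L" if \<tau>: "0 \<le> \<tau>" "\<tau> < \<sigma> (Suc k) - \<sigma> k" for \<tau> k
  proof (rule norm_blinfun_bound)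
    show "0 \<le> L" by (simp add: L_def)
    fix x
    have empty: "impulse_times \<sigma> \<inter> {\<sigma> k<..\<sigma> k + \<tau>} = {}"
      using impulses_between[of k "\<sigma> k" k "\<sigma> k + \<tau>"] \<tau> by simp
    have "ereal \<tau> < sup_dwell \<sigma>"
      unfolding sup_dwell_def less_SUP_iff using \<tau>(2) by auto
    then have "g \<tau> \<le> L"
      using G[OF \<tau>(1)] by (simp add: L_def)
    moreover have "norm (S \<tau> x) \<le> g \<tau> * norm x"
      using g(1)[of "\<sigma> k" "\<sigma> k + \<tau>" x] \<tau>(1) by (simp add: propagator_def impulse_count_def empty)
    ultimately show "norm (S \<tau> x) \<le> L * norm x"
      using mult_right_mono[of "g \<tau>" L "norm x"] by simp
  qed
  have "norm (S \<tau>) \<le> L * L" if \<tau>: "0 \<le> \<tau>" "\<tau> \<le> \<sigma> (Suc k) - \<sigma> k" for \<tau> k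
  proof -
    have "0 < \<sigma> (Suc k) - \<sigma> k" by simp
    then have "norm (S (\<tau> / 2)) \<le> L"
      using \<tau> by (intro inner[of _ k]) linarith+
    moreover have "\<forall>t\<ge>0. \<forall>s\<ge>0. S (t + s) = S t o\<^sub>L S s"
      using S by (simp add: C0_semigroup_def)
    then have "S (\<tau> / 2 + \<tau> / 2) = S (\<tau> / 2) o\<^sub>L S (\<tau> / 2)"
      by (metis \<tau>(1) divide_nonneg_pos zero_less_numeral)
    ultimately show ?thesis
      using norm_blinfun_compose[of "S (\<tau> / 2)" "S (\<tau> / 2)"]
        mult_mono[of "norm (S (\<tau> / 2))" L "norm (S (\<tau> / 2))" L]
      by (simp add: L_def)
  qed
  moreover have "1 * 1 \<le> L * L"
    unfolding L_def by (intro mult_mono) auto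
  ultimately have "impulsive_system \<sigma> S (L * L)"
    using S by unfold_locales auto
  then show thesis by (rule that)
qed

theorem theorem4p1:
  fixes S :: "real \<Rightarrow> 'a::banach \<Rightarrow>\<^sub>L 'a"
    and A :: "'a \<Rightarrow> 'a" and D :: "'a set"
    and J :: "'a \<Rightarrow>\<^sub>L 'a"
    and \<sigma> :: "nat \<Rightarrow> real"
  assumes "generates D A S"
    and "J \<noteq> 0"
    and "blinfun_apply J ` D \<subseteq> D"
    and "\<sigma> \<in> impulse_sequences"
    and "growth_condition S J \<sigma>"
  defines "strong_GES \<equiv>
      (\<exists>M \<alpha> \<rho>. 1 \<le> M \<and> 0 < \<alpha> \<and> 0 < \<rho> \<and> \<rho> < 1 \<and>
         (\<forall>s\<ge>0. \<forall>t\<ge>s. norm (propagator S J \<sigma> t s)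
             \<le> M * \<rho> ^ impulse_count \<sigma> t s * exp (- \<alpha> * (t - s))))"
    and "datko_bound \<equiv>
      (\<exists>p b::real. 1 \<le> p \<and> 0 < b \<and>
         (\<forall>s\<ge>0. \<forall>x. datko_cost S J \<sigma> p s x \<le> ennreal (b powr p * norm x powr p)))"
    and "has_lyapunov \<equiv>
      (\<exists>V p c. 1 \<le> p \<and> 0 < c \<and> lyapunov_functional S J \<sigma> p c V)"
  shows "(strong_GES \<longleftrightarrow> datko_bound) \<and>
         (datko_bound \<longleftrightarrow> has_lyapunov) \<and>
         (strong_GES \<longrightarrow>
           (\<forall>p\<ge>1. (\<forall>t\<ge>0. \<forall>x. datko_cost S J \<sigma> p t x < \<infinity>) \<and>
              (\<exists>c>0. lyapunov_functional S J \<sigma> p c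
                 (\<lambda>t x. enn2real (datko_cost S J \<sigma> p t x)))))"
proof -
  have S: "C0_semigroup S"
    using assms(1) by (simp add: generates_def)
  obtain K where "impulsive_system \<sigma> S K"
    using growth_condition_imp_impulsive_system[OF S assms(4,5)] .
  then interpret impulsive_system \<sigma> S J K .
  have cost_bound: "\<exists>C>0. \<forall>s\<ge>0. \<forall>x. cost p s x \<le> ennreal (C * norm x powr p)"
    if ges: strong_GES and p: "1 \<le> p" for p
  proof -
    obtain M \<alpha> \<rho> where M: "1 \<le> M" "0 < \<alpha>" "0 < \<rho>" "\<rho> < 1"
      and decay: "\<And>s t. 0 \<le> s \<Longrightarrow> s \<le> t \<Longrightarrow>
        norm (U t s) \<le> M * \<rho> ^ impulse_count \<sigma> t s * exp (- \<alpha> * (t - s))"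
      using ges unfolding strong_GES_def by blast
    let ?C = "M powr p * (1 / (\<alpha> * p) + 1 / (1 - \<rho> powr p))"
    have "\<rho> powr p < 1"
      using powr_less_mono2[of p \<rho> 1] M p by simp
    then have "0 < ?C"
      using M p by (intro mult_pos_pos add_pos_pos) auto
    moreover have "cost p s x \<le> ennreal (?C * norm x powr p)" if "0 \<le> s" for s x
      by (rule cost_le_of_decay[OF p _ M(2-4) decay that]) (use M in auto)
    ultimately show ?thesis by blast
  qed
  have ges_lyapunov: "(\<forall>t\<ge>0. \<forall>x. cost p t x < \<infinity>) \<and>
      (\<exists>c>0. lyapunov_functional S J \<sigma> p c (\<lambda>t x. enn2real (cost p t x)))"
    if ges: strong_GES and p: "1 \<le> p" for p
  proof -
    obtain C where C: "0 < C" "\<And>s x. 0 \<le> s \<Longrightarrow> cost p s x \<le> ennreal (C * norm x powr p)"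
      using cost_bound[OF ges p] by blast
    have "lyapunov_functional S J \<sigma> p C (\<lambda>t x. enn2real (cost p t x))"
      using C by (intro lyapunov_functional_cost[OF p]) auto
    moreover have "cost p t x < \<infinity>" if "0 \<le> t" for t x
      using C(2)[OF that, of x] by (simp add: le_less_trans)
    ultimately show ?thesis using C(1) by blast
  qed
  have datko_ges: strong_GES if datko_bound
  proof -
    obtain p b where pb: "1 \<le> p" "0 < b"
      "\<And>s x. 0 \<le> s \<Longrightarrow> cost p s x \<le> ennreal (b powr p * norm x powr p)"
      using \<open>datko_bound\<close> unfolding datko_bound_def by blast
    obtain M \<alpha> where M: "1 \<le> M" "0 < \<alpha>" "\<forall>s\<ge>0. \<forall>t\<ge>s. norm (U t s)
        \<le> M * exp (- \<alpha>) ^ impulse_count \<sigma> t s * exp (- \<alpha> * (t - s))"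
      using propagator_decay_of_cost_bound[OF pb] by blast
    show ?thesis
      unfolding strong_GES_def
      by (rule exI[of _ M], rule exI[of _ \<alpha>], rule exI[of _ "exp (- \<alpha>)"]) (use M in simp)
  qed
  have lyapunov_datko: datko_bound if has_lyapunov
  proof -
    obtain V p c where V: "1 \<le> p" "0 < c" "lyapunov_functional S J \<sigma> p c V"
      using \<open>has_lyapunov\<close> unfolding has_lyapunov_def by blast
    have "cost p s x \<le> ennreal ((c powr (1 / p)) powr p * norm x powr p)" if "0 \<le> s" for s x
    proof -
      have "V s x \<le> c * norm x powr p"
        using V(3) that by (simp add: lyapunov_functional_def)
      moreover have "(c powr (1 / p)) powr p = c"
        using V by (simp add: powr_powr)
      ultimately show ?thesis
        using cost_le_lyapunov[OF V(1,3) that, of x] by (simp add: ennreal_leI order_trans)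
    qed
    then show ?thesis
      unfolding datko_bound_def using V
      by (intro exI[of _ p] exI[of _ "c powr (1 / p)"]) auto
  qed
  have ges_has_lyapunov: has_lyapunov if strong_GES
    unfolding has_lyapunov_def using ges_lyapunov[OF that order_refl] by blast
  show ?thesis
    using datko_ges lyapunov_datko ges_has_lyapunov ges_lyapunov by blast
qed

end
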